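(* Let $L$ be a Leibniz algebra over a field $\mathbb{F}$, let $H$ be a central ideal of $L$, let $0\to H\to L\xrightarrow{\beta} L/H\to 0$ be the natural central extension, let $\mu$ be a section of $\beta$, and let $A$ be a central $L$-module. Then the sequence \[0\to \mathrm{Hom}(L/H,A)\xrightarrow{\mathrm{Inf}_1}\mathrm{Hom}(L,A)\xrightarrow{\mathrm{Res}}\mathrm{Hom}(H,A)\xrightarrow{\mathrm{Tra}}\mathcal{H}^2(L/H,A)\xrightarrow{\mathrm{Inf}_2}\mathcal{H}^2(L,A)\] is exact.
   Context: A (left) Leibniz algebra over a field $\mathbb{F}$ is an $\mathbb{F}$-vector space with a bilinear multiplication satisfying $x(yz)=(xy)z+y(xz)$. Ideals are two-sided. The center is $Z(L)=\{z\in L: zx=xz=0 \text{ for all } x\in L\}$; an ideal is central if it is contained in $Z(L)$. A central $L$-module $A$ is a vector space on which $L$ acts trivially (on both sides), regarded as a Leibniz algebra with zero multiplication. $\mathrm{Hom}$ denotes the vector space of Leibniz algebra homomorphisms. A section of a surjective homomorphism $\beta$ is a linear map $\mu$ with $\beta\circ\mu=\mathrm{id}$. For a Leibniz algebra $B$ and a central module $A$: $\mathcal{Z}^2(B,A)$ is the space of 2-cocycles, i.e. bilinear maps $f:B\times B\to A$ with $f(i,jk)=f(ij,k)+f(j,ik)$ for all $i,j,k\in B$; $\mathcal{B}^2(B,A)$ is the space of 2-coboundaries, i.e. those $f$ for which there is a linear $\varepsilon:B\to A$ with $f(i,j)=-\varepsilon(ij)$; and $\mathcal{H}^2(B,A)=\mathcal{Z}^2(B,A)/\mathcal{B}^2(B,A)$.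 The maps are: $\mathrm{Inf}_1(\chi)=\chi\circ\beta$; $\mathrm{Res}(\pi)=\pi\circ\iota$ with $\iota:H\to L$ the inclusion; $\mathrm{Tra}(\chi)=\overline{\chi\circ f}$ (the cohomology class), where $f:L/H\times L/H\to H$ is $f(\overline{x},\overline{y})=\mu(\overline{x})\mu(\overline{y})-\mu(\overline{x}\,\overline{y})$ (the class is independent of the choice of section $\mu$); $\mathrm{Inf}_2(f+\mathcal{B}^2(L/H,A))=f'+\mathcal{B}^2(L,A)$ with $f'(x,y)=f(\beta(x),\beta(y))$. *)

theory Defs
  imports "HOL-Algebra.QuotRing" "HOL-Algebra.Module"
begin

definition module_hom ::
  "('f, 'r) ring_scheme \<Rightarrow> ('f, 'a, 'm) module_scheme \<Rightarrow> ('f, 'b, 'n) module_scheme \<Rightarrow> ('a \<Rightarrow> 'b) set"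
  where "module_hom F U V =
    {g \<in> carrier U \<rightarrow> carrier V.
       (\<forall>x\<in>carrier U. \<forall>y\<in>carrier U. g (x \<oplus>\<^bsub>U\<^esub> y) = g x \<oplus>\<^bsub>V\<^esub> g y) \<and>
       (\<forall>c\<in>carrier F. \<forall>x\<in>carrier U. g (c \<odot>\<^bsub>U\<^esub> x) = c \<odot>\<^bsub>V\<^esub> g x)}"

text \<open>Exactness of \<open>U \<rightarrow> V \<rightarrow> W\<close> at \<open>V\<close> as a sequence of \<open>F\<close>-modules and linear maps. The
  predicate \<open>exact_seq\<close> of the library forces all terms of the sequence to have the same
  element type.\<close>

definition exact_at ::
  "('f, 'r) ring_scheme \<Rightarrow> ('f, 'u, 'm) module_scheme \<Rightarrow> ('f, 'v, 'n) module_scheme \<Rightarrow>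
   ('f, 'w, 'k) module_scheme \<Rightarrow> ('u \<Rightarrow> 'v) \<Rightarrow> ('v \<Rightarrow> 'w) \<Rightarrow> bool"
  where "exact_at F U V W g h \<longleftrightarrow>
    module F U \<and> module F V \<and> module F W \<and>
    g \<in> module_hom F U V \<and> h \<in> module_hom F V W \<and>
    g ` carrier U = a_kernel V W h"

text \<open>The multiplication of a Leibniz algebra is the \<open>mult\<close> component of the \<open>module\<close> record.
  The \<open>one\<close> component inherited from rings carries no meaning, here and below.\<close>

locale leibniz_algebra = field F + module F L
  for F :: "('f, 'r) ring_scheme" and L :: "('f, 'l, 'm) module_scheme" +
  assumes mult_linear_right: "x \<in> carrier L \<Longrightarrow> (\<lambda>y. x \<otimes>\<^bsub>L\<^esub> y) \<in> module_hom F L L"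
    and mult_linear_left: "y \<in> carrier L \<Longrightarrow> (\<lambda>x. x \<otimes>\<^bsub>L\<^esub> y) \<in> module_hom F L L"
    and leibniz_identity:
      "\<lbrakk>x \<in> carrier L; y \<in> carrier L; z \<in> carrier L\<rbrakk> \<Longrightarrow>
        x \<otimes>\<^bsub>L\<^esub> (y \<otimes>\<^bsub>L\<^esub> z) = (x \<otimes>\<^bsub>L\<^esub> y) \<otimes>\<^bsub>L\<^esub> z \<oplus>\<^bsub>L\<^esub> y \<otimes>\<^bsub>L\<^esub> (x \<otimes>\<^bsub>L\<^esub> z)"

text \<open>Since both actions on a central module are zero, they are not recorded as data: a central
  module is a vector space, regarded as a Leibniz algebra with zero multiplication.\<close>

locale central_module = field F + module F A
  for F :: "('f, 'r) ring_scheme" and A :: "('f, 'a, 'm) module_scheme" +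
  assumes mult_zero: "\<lbrakk>a \<in> carrier A; b \<in> carrier A\<rbrakk> \<Longrightarrow> a \<otimes>\<^bsub>A\<^esub> b = \<zero>\<^bsub>A\<^esub>"

definition leibniz_center :: "('f, 'l, 'm) module_scheme \<Rightarrow> 'l set"
  where "leibniz_center L =
    {z \<in> carrier L. \<forall>x\<in>carrier L. z \<otimes>\<^bsub>L\<^esub> x = \<zero>\<^bsub>L\<^esub> \<and> x \<otimes>\<^bsub>L\<^esub> z = \<zero>\<^bsub>L\<^esub>}"

definition leibniz_ideal :: "('f, 'r) ring_scheme \<Rightarrow> 'l set \<Rightarrow> ('f, 'l, 'm) module_scheme \<Rightarrow> bool"
  where "leibniz_ideal F H L \<longleftrightarrow>
    submodule H F L \<and> (\<forall>x\<in>carrier L. \<forall>h\<in>H. x \<otimes>\<^bsub>L\<^esub> h \<in> H \<and> h \<otimes>\<^bsub>L\<^esub> x \<in> H)"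

definition central_ideal :: "('f, 'r) ring_scheme \<Rightarrow> 'l set \<Rightarrow> ('f, 'l, 'm) module_scheme \<Rightarrow> bool"
  where "central_ideal F H L \<longleftrightarrow> leibniz_ideal F H L \<and> H \<subseteq> leibniz_center L"

text \<open>\<open>FactRing\<close> supplies the cosets with their addition and multiplication; scalar
  multiplication is lifted in the style of \<open>rcoset_mult\<close>, as a union over all representatives.
  The same construction serves for the vector space quotient defining cohomology, where the
  multiplication is irrelevant.\<close>

definition quot_module :: "('f, 'l, 'm) module_scheme \<Rightarrow> 'l set \<Rightarrow> ('f, 'l set) module"
  where "quot_module M N =
    ring.extend (M Quot N) (module.fields (\<lambda>c X. \<Union>x\<in>X. N +>\<^bsub>M\<^esub> (c \<odot>\<^bsub>M\<^esub> x)))"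

definition quot_proj :: "('f, 'l, 'm) module_scheme \<Rightarrow> 'l set \<Rightarrow> 'l \<Rightarrow> 'l set"
  where "quot_proj M N x = N +>\<^bsub>M\<^esub> x"

definition linear_section ::
  "('f, 'r) ring_scheme \<Rightarrow> ('f, 'a, 'm) module_scheme \<Rightarrow> ('f, 'b, 'n) module_scheme \<Rightarrow>
   ('a \<Rightarrow> 'b) \<Rightarrow> ('b \<Rightarrow> 'a) \<Rightarrow> bool"
  where "linear_section F U V \<beta> \<mu> \<longleftrightarrow> \<mu> \<in> module_hom F V U \<and> (\<forall>v\<in>carrier V. \<beta> (\<mu> v) = v)"

text \<open>The elements of the spaces of homomorphisms and cocycles are extensional functions
  (\<open>undefined\<close> outside the domain), so that equality of functions is equality on the carrier.\<close>

definition pointwise_module :: "('x \<Rightarrow> 'a) set \<Rightarrow> 'x set \<Rightarrow> ('f, 'a, 'm) module_scheme \<Rightarrow> ('f, 'x \<Rightarrow> 'a) module"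
  where "pointwise_module C S A =
    \<lparr>carrier = C, mult = undefined, one = undefined,
     zero = (\<lambda>x\<in>S. \<zero>\<^bsub>A\<^esub>), add = (\<lambda>g h. \<lambda>x\<in>S. g x \<oplus>\<^bsub>A\<^esub> h x),
     smult = (\<lambda>c g. \<lambda>x\<in>S. c \<odot>\<^bsub>A\<^esub> g x)\<rparr>"

definition leibniz_hom ::
  "('f, 'r) ring_scheme \<Rightarrow> ('f, 'b, 'm) module_scheme \<Rightarrow> ('f, 'a, 'n) module_scheme \<Rightarrow> ('b \<Rightarrow> 'a) set"
  where "leibniz_hom F B A =
    {\<phi> \<in> carrier B \<rightarrow>\<^sub>E carrier A. \<phi> \<in> module_hom F B A \<and>
       (\<forall>x\<in>carrier B. \<forall>y\<in>carrier B. \<phi> (x \<otimes>\<^bsub>B\<^esub> y) = \<phi> x \<otimes>\<^bsub>A\<^esub> \<phi> y)}"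

definition Hom ::
  "('f, 'r) ring_scheme \<Rightarrow> ('f, 'b, 'm) module_scheme \<Rightarrow> ('f, 'a, 'n) module_scheme \<Rightarrow> ('f, 'b \<Rightarrow> 'a) module"
  where "Hom F B A = pointwise_module (leibniz_hom F B A) (carrier B) A"

definition cocycles2 ::
  "('f, 'r) ring_scheme \<Rightarrow> ('f, 'b, 'm) module_scheme \<Rightarrow> ('f, 'a, 'n) module_scheme \<Rightarrow> ('b \<times> 'b \<Rightarrow> 'a) set"
  where "cocycles2 F B A =
    {f \<in> carrier B \<times> carrier B \<rightarrow>\<^sub>E carrier A.
       (\<forall>i\<in>carrier B. (\<lambda>j. f (i, j)) \<in> module_hom F B A) \<and>
       (\<forall>j\<in>carrier B. (\<lambda>i. f (i, j)) \<in> module_hom F B A) \<and>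
       (\<forall>i\<in>carrier B. \<forall>j\<in>carrier B. \<forall>k\<in>carrier B.
          f (i, j \<otimes>\<^bsub>B\<^esub> k) = f (i \<otimes>\<^bsub>B\<^esub> j, k) \<oplus>\<^bsub>A\<^esub> f (j, i \<otimes>\<^bsub>B\<^esub> k))}"

definition coboundaries2 ::
  "('f, 'r) ring_scheme \<Rightarrow> ('f, 'b, 'm) module_scheme \<Rightarrow> ('f, 'a, 'n) module_scheme \<Rightarrow> ('b \<times> 'b \<Rightarrow> 'a) set"
  where "coboundaries2 F B A =
    {f \<in> carrier B \<times> carrier B \<rightarrow>\<^sub>E carrier A.
       \<exists>\<epsilon>\<in>module_hom F B A. \<forall>i\<in>carrier B. \<forall>j\<in>carrier B. f (i, j) = \<ominus>\<^bsub>A\<^esub> \<epsilon> (i \<otimes>\<^bsub>B\<^esub> j)}"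

definition Z2 ::
  "('f, 'r) ring_scheme \<Rightarrow> ('f, 'b, 'm) module_scheme \<Rightarrow> ('f, 'a, 'n) module_scheme \<Rightarrow>
   ('f, 'b \<times> 'b \<Rightarrow> 'a) module"
  where "Z2 F B A = pointwise_module (cocycles2 F B A) (carrier B \<times> carrier B) A"

definition H2 ::
  "('f, 'r) ring_scheme \<Rightarrow> ('f, 'b, 'm) module_scheme \<Rightarrow> ('f, 'a, 'n) module_scheme \<Rightarrow>
   ('f, ('b \<times> 'b \<Rightarrow> 'a) set) module"
  where "H2 F B A = quot_module (Z2 F B A) (coboundaries2 F B A)"

definition coh_class ::
  "('f, 'r) ring_scheme \<Rightarrow> ('f, 'b, 'm) module_scheme \<Rightarrow> ('f, 'a, 'n) module_scheme \<Rightarrow>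
   ('b \<times> 'b \<Rightarrow> 'a) \<Rightarrow> ('b \<times> 'b \<Rightarrow> 'a) set"
  where "coh_class F B A f = quot_proj (Z2 F B A) (coboundaries2 F B A) f"

definition Inf1 :: "('f, 'l, 'm) module_scheme \<Rightarrow> 'l set \<Rightarrow> ('l set \<Rightarrow> 'a) \<Rightarrow> 'l \<Rightarrow> 'a"
  where "Inf1 L H \<chi> = (\<lambda>x\<in>carrier L. \<chi> (quot_proj L H x))"

text \<open>Composition with the inclusion of \<open>H\<close> is restriction to \<open>H\<close>.\<close>

definition Res :: "'l set \<Rightarrow> ('l \<Rightarrow> 'a) \<Rightarrow> 'l \<Rightarrow> 'a"
  where "Res H \<pi> = restrict \<pi> H"

definition section_cocycle ::
  "('f, 'l, 'm) module_scheme \<Rightarrow> 'l set \<Rightarrow> ('l set \<Rightarrow> 'l) \<Rightarrow> 'l set \<times> 'l set \<Rightarrow> 'l"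
  where "section_cocycle L H \<mu> =
    (\<lambda>(X, Y). \<mu> X \<otimes>\<^bsub>L\<^esub> \<mu> Y \<ominus>\<^bsub>L\<^esub> \<mu> (X \<otimes>\<^bsub>quot_module L H\<^esub> Y))"

definition Tra ::
  "('f, 'r) ring_scheme \<Rightarrow> ('f, 'l, 'm) module_scheme \<Rightarrow> 'l set \<Rightarrow> ('f, 'a, 'n) module_scheme \<Rightarrow>
   ('l set \<Rightarrow> 'l) \<Rightarrow> ('l \<Rightarrow> 'a) \<Rightarrow> ('l set \<times> 'l set \<Rightarrow> 'a) set"
  where "Tra F L H A \<mu> \<chi> =
    coh_class F (quot_module L H) A
      (\<lambda>p\<in>carrier (quot_module L H) \<times> carrier (quot_module L H). \<chi> (section_cocycle L H \<mu> p))"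

definition inflate_cocycle ::
  "('f, 'l, 'm) module_scheme \<Rightarrow> 'l set \<Rightarrow> ('l set \<times> 'l set \<Rightarrow> 'a) \<Rightarrow> 'l \<times> 'l \<Rightarrow> 'a"
  where "inflate_cocycle L H f =
    (\<lambda>(x, y)\<in>carrier L \<times> carrier L. f (quot_proj L H x, quot_proj L H y))"

text \<open>The class of \<open>inflate_cocycle L H f\<close> is the same for all representatives \<open>f\<close> of \<open>C\<close>, so
  that the union is that class.\<close>

definition Inf2 ::
  "('f, 'r) ring_scheme \<Rightarrow> ('f, 'l, 'm) module_scheme \<Rightarrow> 'l set \<Rightarrow> ('f, 'a, 'n) module_scheme \<Rightarrow>
   ('l set \<times> 'l set \<Rightarrow> 'a) set \<Rightarrow> ('l \<times> 'l \<Rightarrow> 'a) set"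
  where "Inf2 F L H A C = (\<Union>f\<in>C. coh_class F L A (inflate_cocycle L H f))"

end

theory Submission
  imports Defs
begin

text \<open>Since \<open>H\<close> is central, the product of \<open>L\<close> only depends on classes modulo \<open>H\<close>. Hence the
  linear retraction \<open>\<kappa> x = x - \<mu> (\<beta> x)\<close> of \<open>L\<close> onto \<open>H\<close> satisfies \<open>f (\<beta> x, \<beta> y) = \<kappa> (x y)\<close> for the
  cocycle \<open>f\<close> of \<open>\<mu>\<close>, and every preimage needed is written down with it: if \<open>\<chi> \<circ> f\<close> is the coboundary
  of \<open>\<epsilon>\<close> then \<open>\<chi> \<circ> \<kappa> + \<epsilon> \<circ> \<beta>\<close> extends \<open>\<chi>\<close> to \<open>L\<close>; the inflation of \<open>\<chi> \<circ> f\<close> is the coboundary of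
  \<open>- \<chi> \<circ> \<kappa>\<close>; and if the inflation of \<open>g\<close> is the coboundary of \<open>\<epsilon>\<close> then \<open>g\<close> is cohomologous to
  \<open>\<chi> \<circ> f\<close> with \<open>\<chi>\<close> the restriction of \<open>- \<epsilon>\<close> to \<open>H\<close>.\<close>

subsection \<open>Linear maps\<close>

lemma module_homI:
  assumes "\<And>x. x \<in> carrier U \<Longrightarrow> g x \<in> carrier V"
    and "\<And>x y. \<lbrakk>x \<in> carrier U; y \<in> carrier U\<rbrakk> \<Longrightarrow> g (x \<oplus>\<^bsub>U\<^esub> y) = g x \<oplus>\<^bsub>V\<^esub> g y"
    and "\<And>c x. \<lbrakk>c \<in> carrier F; x \<in> carrier U\<rbrakk> \<Longrightarrow> g (c \<odot>\<^bsub>U\<^esub> x) = c \<odot>\<^bsub>V\<^esub> g x"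
  shows "g \<in> module_hom F U V"
  using assms by (auto simp: module_hom_def)

lemma module_hom_closed: "\<lbrakk>g \<in> module_hom F U V; x \<in> carrier U\<rbrakk> \<Longrightarrow> g x \<in> carrier V"
  by (auto simp: module_hom_def)

lemma module_hom_add:
  "\<lbrakk>g \<in> module_hom F U V; x \<in> carrier U; y \<in> carrier U\<rbrakk> \<Longrightarrow> g (x \<oplus>\<^bsub>U\<^esub> y) = g x \<oplus>\<^bsub>V\<^esub> g y"
  by (auto simp: module_hom_def)

lemma module_hom_smult:
  "\<lbrakk>g \<in> module_hom F U V; c \<in> carrier F; x \<in> carrier U\<rbrakk> \<Longrightarrow> g (c \<odot>\<^bsub>U\<^esub> x) = c \<odot>\<^bsub>V\<^esub> g x"
  by (auto simp: module_hom_def)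

lemma module_hom_zero:
  assumes "module F U" "module F V" "g \<in> module_hom F U V"
  shows "g \<zero>\<^bsub>U\<^esub> = \<zero>\<^bsub>V\<^esub>"
proof -
  interpret U: module F U by fact
  interpret V: module F V by fact
  \<comment> \<open>Homogeneity for the scalar zero. The null rules of \<open>U\<close> are
    withheld, since they would simplify the argument of \<open>g\<close> before
    \<open>module_hom_smult\<close> can act on it.\<close>
  have "g (\<zero>\<^bsub>F\<^esub> \<odot>\<^bsub>U\<^esub> \<zero>\<^bsub>U\<^esub>) = \<zero>\<^bsub>F\<^esub> \<odot>\<^bsub>V\<^esub> g \<zero>\<^bsub>U\<^esub>"
    using assms(3) by (simp add: module_hom_smult del: U.smult_l_null U.smult_r_null)
  then show ?thesis using module_hom_closed[OF assms(3)] by simp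
qed

lemma module_hom_diff:
  assumes "module F U" "module F V" "g \<in> module_hom F U V" "x \<in> carrier U" "y \<in> carrier U"
  shows "g (x \<ominus>\<^bsub>U\<^esub> y) = g x \<ominus>\<^bsub>V\<^esub> g y"
proof -
  interpret U: module F U by fact
  interpret V: module F V by fact
  have "g (\<ominus>\<^bsub>U\<^esub> y) \<oplus>\<^bsub>V\<^esub> g y = g (\<ominus>\<^bsub>U\<^esub> y \<oplus>\<^bsub>U\<^esub> y)"
    using assms by (simp add: module_hom_add)
  then have "g (\<ominus>\<^bsub>U\<^esub> y) \<oplus>\<^bsub>V\<^esub> g y = \<zero>\<^bsub>V\<^esub>"
    using assms by (simp add: U.M.l_neg module_hom_zero)
  then have "g (\<ominus>\<^bsub>U\<^esub> y) = \<ominus>\<^bsub>V\<^esub> g y"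
    using assms by (metis U.M.a_inv_closed V.M.minus_equality module_hom_closed)
  then show ?thesis
    using assms by (simp add: a_minus_def module_hom_add)
qed

lemma module_hom_comp:
  assumes "g \<in> module_hom F U V" "h \<in> module_hom F V W"
  shows "(\<lambda>x. h (g x)) \<in> module_hom F U W"
  using assms by (intro module_homI) (auto simp: module_hom_closed module_hom_add module_hom_smult)

text \<open>Linearity tests values at points of the carrier alone, and \<open>module F U\<close>
  keeps sums and multiples there. This lets a linear map be exchanged for its extensional
  restriction.\<close>

lemma module_hom_cong:
  assumes "module F U" "\<And>x. x \<in> carrier U \<Longrightarrow> g x = h x"
  shows "g \<in> module_hom F U V \<longleftrightarrow> h \<in> module_hom F U V"
proof -
  interpret U: module F U by fact
  show ?thesis using assms(2) by (simp add: module_hom_def Pi_def)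
qed

lemma module_hom_pointwise_zero:
  assumes "module F V" shows "(\<lambda>x. \<zero>\<^bsub>V\<^esub>) \<in> module_hom F U V"
proof -
  interpret V: module F V by fact
  show ?thesis by (intro module_homI) auto
qed

lemma module_hom_pointwise_add:
  assumes "module F V" "g \<in> module_hom F U V" "h \<in> module_hom F U V"
  shows "(\<lambda>x. g x \<oplus>\<^bsub>V\<^esub> h x) \<in> module_hom F U V"
proof -
  interpret V: module F V by fact
  show ?thesis using assms(2,3)
    by (intro module_homI)
      (auto simp: module_hom_closed module_hom_add module_hom_smult V.M.a_ac V.smult_r_distr)
qed

lemma module_hom_pointwise_smult:
  assumes "module F V" "g \<in> module_hom F U V" "c \<in> carrier F"
  shows "(\<lambda>x. c \<odot>\<^bsub>V\<^esub> g x) \<in> module_hom F U V"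
proof -
  interpret V: module F V by fact
  show ?thesis using assms(2,3)
    by (intro module_homI)
      (auto simp: module_hom_closed module_hom_add module_hom_smult V.smult_r_distr
        V.smult_assoc1[symmetric] V.R.m_comm)
qed

lemma module_hom_pointwise_minus:
  assumes "module F V" "g \<in> module_hom F U V"
  shows "(\<lambda>x. \<ominus>\<^bsub>V\<^esub> g x) \<in> module_hom F U V"
proof -
  interpret V: module F V by fact
  show ?thesis using assms(2)
    by (intro module_homI)
      (auto simp: module_hom_closed module_hom_add module_hom_smult V.M.minus_add V.smult_r_minus)
qed

lemma module_hom_pointwise_diff:
  assumes "module F V" "g \<in> module_hom F U V" "h \<in> module_hom F U V"
  shows "(\<lambda>x. g x \<ominus>\<^bsub>V\<^esub> h x) \<in> module_hom F U V"
  using assms by (simp add: a_minus_def module_hom_pointwise_add module_hom_pointwise_minus)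

subsection \<open>Modules of functions and quotient modules\<close>

text \<open>All laws are inherited pointwise from \<open>A\<close>. Extensionality of the members of
  \<open>C\<close> makes pointwise equality on \<open>S\<close> an equality of functions.\<close>

lemma module_pointwise_module:
  assumes "module F A"
    and C: "C \<subseteq> S \<rightarrow>\<^sub>E carrier A"
    and zero: "(\<lambda>x\<in>S. \<zero>\<^bsub>A\<^esub>) \<in> C"
    and add: "\<And>g h. \<lbrakk>g \<in> C; h \<in> C\<rbrakk> \<Longrightarrow> (\<lambda>x\<in>S. g x \<oplus>\<^bsub>A\<^esub> h x) \<in> C"
    and smult: "\<And>c g. \<lbrakk>c \<in> carrier F; g \<in> C\<rbrakk> \<Longrightarrow> (\<lambda>x\<in>S. c \<odot>\<^bsub>A\<^esub> g x) \<in> C"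
  shows "module F (pointwise_module C S A)"
proof -
  interpret A: module F A by fact
  have [simp]: "g x \<in> carrier A" if "g \<in> C" "x \<in> S" for g x
    using C that by (meson PiE_mem subsetD)
  have ext: "(\<lambda>x\<in>S. g x) = g" if "g \<in> C" for g
    using C that by (meson PiE_restrict subsetD)
  show ?thesis
  proof (rule moduleI)
    show "abelian_group (pointwise_module C S A)"
    proof (rule abelian_groupI)
      fix g assume "g \<in> carrier (pointwise_module C S A)"
      then have g: "g \<in> C" by (simp add: pointwise_module_def)
      \<comment> \<open>The additive inverse is the multiple by -1, so closure under scalars
        supplies it.\<close>
      then have "(\<lambda>x\<in>S. (\<ominus>\<^bsub>F\<^esub> \<one>\<^bsub>F\<^esub>) \<odot>\<^bsub>A\<^esub> g x) \<in> C" by (simp add: smult)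
      moreover have "(\<lambda>x\<in>S. (\<lambda>x\<in>S. (\<ominus>\<^bsub>F\<^esub> \<one>\<^bsub>F\<^esub>) \<odot>\<^bsub>A\<^esub> g x) x \<oplus>\<^bsub>A\<^esub> g x) = (\<lambda>x\<in>S. \<zero>\<^bsub>A\<^esub>)"
        using g by (intro restrict_ext) (simp add: A.smult_l_minus A.M.l_neg)
      ultimately show "\<exists>h\<in>carrier (pointwise_module C S A).
          h \<oplus>\<^bsub>pointwise_module C S A\<^esub> g = \<zero>\<^bsub>pointwise_module C S A\<^esub>"
        unfolding pointwise_module_def ring.simps partial_object.simps by blast
      show "\<zero>\<^bsub>pointwise_module C S A\<^esub> \<oplus>\<^bsub>pointwise_module C S A\<^esub> g = g"
        using g ext[OF g] by (simp add: pointwise_module_def cong: restrict_cong)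
    qed (auto simp: pointwise_module_def zero add A.M.a_ac intro!: restrict_ext)
    show "\<one>\<^bsub>F\<^esub> \<odot>\<^bsub>pointwise_module C S A\<^esub> g = g"
      if "g \<in> carrier (pointwise_module C S A)" for g
      using that ext[of g] by (simp add: pointwise_module_def cong: restrict_cong)
  qed (auto simp: pointwise_module_def smult A.R.cring_axioms A.smult_l_distr A.smult_r_distr
      A.smult_assoc1 intro!: restrict_ext)
qed

text \<open>Serves twice: for \<open>L\<close> modulo \<open>H\<close> and for cocycles modulo
  coboundaries. Nothing is assumed about the multiplication of \<open>M\<close>, which is
  meaningless in the second case.\<close>

locale quotient_space = module F M + sub?: submodule N F M
  for F :: "('f, 'r) ring_scheme" and M :: "('f, 'l, 'm) module_scheme" and N
begin

sublocale abelian_subgroup N M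
  by (rule abelian_subgroupI3) (unfold_locales)

abbreviation proj where "proj \<equiv> quot_proj M N"
abbreviation Q where "Q \<equiv> quot_module M N"

lemma carrier_quot: "carrier Q = proj ` carrier M"
  by (auto simp: quot_module_def ring.defs module.defs FactRing_simps quot_proj_def)

lemma proj_eq_iff:
  assumes "x \<in> carrier M" "y \<in> carrier M"
  shows "proj x = proj y \<longleftrightarrow> (\<exists>n\<in>N. x = n \<oplus>\<^bsub>M\<^esub> y)"
proof -
  have "proj x = proj y \<longleftrightarrow> x \<in> N +>\<^bsub>M\<^esub> y"
    unfolding quot_proj_def using assms a_repr_independence' a_repr_independenceD by metis
  then show ?thesis by (auto simp: a_r_coset_def r_coset_def)
qed

text \<open>The cosets partition the carrier. In this form a union over a coset becomes a union over
  all representatives of the class.\<close>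

lemma mem_proj_iff:
  assumes "x \<in> carrier M"
  shows "y \<in> proj x \<longleftrightarrow> y \<in> carrier M \<and> proj y = proj x"
  unfolding quot_proj_def
  using assms a_repr_independence' a_repr_independenceD a_elemrcos_carrier by metis

lemma proj_zero: "\<zero>\<^bsub>Q\<^esub> = proj \<zero>\<^bsub>M\<^esub>"
  using a_rcos_const[OF zero_closed]
  by (simp add: quot_module_def ring.defs module.defs FactRing_def quot_proj_def)

lemma proj_eq_zero_iff: "x \<in> carrier M \<Longrightarrow> proj x = \<zero>\<^bsub>Q\<^esub> \<longleftrightarrow> x \<in> N"
  by (auto simp: proj_zero proj_eq_iff)

lemma proj_add:
  "\<lbrakk>x \<in> carrier M; y \<in> carrier M\<rbrakk> \<Longrightarrow> proj (x \<oplus>\<^bsub>M\<^esub> y) = proj x \<oplus>\<^bsub>Q\<^esub> proj y"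
  by (simp add: quot_module_def ring.defs module.defs FactRing_def quot_proj_def a_rcos_sum)

lemma proj_smult:
  assumes c: "c \<in> carrier F" and x: "x \<in> carrier M"
  shows "proj (c \<odot>\<^bsub>M\<^esub> x) = c \<odot>\<^bsub>Q\<^esub> proj x"
proof -
  \<comment> \<open>Scalar multiplication of cosets is a union over representatives. All sets in
    that union agree, because \<open>N\<close> is closed under scalars.\<close>
  have "proj (c \<odot>\<^bsub>M\<^esub> y) = proj (c \<odot>\<^bsub>M\<^esub> x)" if "y \<in> proj x" for y
  proof -
    have y: "y \<in> carrier M" "proj y = proj x" using that x by (auto simp: mem_proj_iff)
    then obtain n where n: "n \<in> N" "y = n \<oplus>\<^bsub>M\<^esub> x" using x by (auto simp: proj_eq_iff)
    then have "c \<odot>\<^bsub>M\<^esub> y = c \<odot>\<^bsub>M\<^esub> n \<oplus>\<^bsub>M\<^esub> c \<odot>\<^bsub>M\<^esub> x"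
      using c x by (simp add: smult_r_distr)
    then show ?thesis
      using c x y n by (auto simp: proj_eq_iff)
  qed
  \<comment> \<open>The union is thus nonempty, hence equal to the common value of its
    members.\<close>
  moreover have "x \<in> proj x" using x by (simp add: mem_proj_iff)
  moreover have "c \<odot>\<^bsub>Q\<^esub> proj x = (\<Union>y\<in>proj x. proj (c \<odot>\<^bsub>M\<^esub> y))"
    by (simp add: quot_module_def ring.defs module.defs FactRing_def quot_proj_def)
  ultimately show ?thesis by blast
qed

lemma module_quot: "module F Q"
proof (rule moduleI)
  show "abelian_group Q"
  proof (rule abelian_groupI)
    fix X assume "X \<in> carrier Q"
    then obtain x where x: "x \<in> carrier M" "X = proj x" by (auto simp: carrier_quot)
    then have "proj (\<ominus>\<^bsub>M\<^esub> x) \<oplus>\<^bsub>Q\<^esub> X = \<zero>\<^bsub>Q\<^esub>"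
      by (simp add: proj_add[symmetric] proj_zero M.l_neg)
    then show "\<exists>Y\<in>carrier Q. Y \<oplus>\<^bsub>Q\<^esub> X = \<zero>\<^bsub>Q\<^esub>"
      using x by (auto simp: carrier_quot)
  qed (auto simp: carrier_quot proj_zero proj_add[symmetric] M.a_ac)
qed (auto simp: carrier_quot proj_add[symmetric] proj_smult[symmetric] smult_l_distr smult_r_distr
    smult_assoc1 R.cring_axioms)

lemma proj_hom: "proj \<in> module_hom F M Q"
  by (intro module_homI) (auto simp: carrier_quot proj_add proj_smult)

text \<open>The product of cosets is again a union over representatives. Independence of their
  choice is a hypothesis, because \<open>N\<close> is a mere subspace here; for an ideal it is
  verified later.\<close>

lemma quot_mult:
  assumes x: "x \<in> carrier M" and y: "y \<in> carrier M"
    and welldef: "\<And>x' y'. \<lbrakk>x' \<in> carrier M; y' \<in> carrier M; proj x' = proj x; proj y' = proj y\<rbrakk>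
      \<Longrightarrow> proj (x' \<otimes>\<^bsub>M\<^esub> y') = proj (x \<otimes>\<^bsub>M\<^esub> y)"
  shows "proj (x \<otimes>\<^bsub>M\<^esub> y) = proj x \<otimes>\<^bsub>Q\<^esub> proj y"
proof -
  have "proj x \<otimes>\<^bsub>Q\<^esub> proj y = (\<Union>x'\<in>proj x. \<Union>y'\<in>proj y. proj (x' \<otimes>\<^bsub>M\<^esub> y'))"
    by (simp add: quot_module_def ring.defs module.defs FactRing_def rcoset_mult_def quot_proj_def)
  moreover have "x \<in> proj x" "y \<in> proj y" using x y by (simp_all add: mem_proj_iff)
  moreover have "proj (x' \<otimes>\<^bsub>M\<^esub> y') = proj (x \<otimes>\<^bsub>M\<^esub> y)" if "x' \<in> proj x" "y' \<in> proj y" for x' y'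
    using that x y by (intro welldef) (simp_all add: mem_proj_iff)
  ultimately show ?thesis by blast
qed

end

subsection \<open>Leibniz algebras and their second cohomology\<close>

context leibniz_algebra
begin

lemma mult_closed: "\<lbrakk>x \<in> carrier L; y \<in> carrier L\<rbrakk> \<Longrightarrow> x \<otimes>\<^bsub>L\<^esub> y \<in> carrier L"
  using module_hom_closed[OF mult_linear_right] .

text \<open>Makes homomorphisms from \<open>H\<close> to \<open>A\<close> meaningful as
  homomorphisms of Leibniz algebras.\<close>

lemma leibniz_algebra_ideal:
  assumes "leibniz_ideal F H L"
  shows "leibniz_algebra F (L\<lparr>carrier := H\<rparr>)" (is "leibniz_algebra F ?H")
proof -
  have sub: "submodule H F L"
    and ideal: "\<And>x h. \<lbrakk>x \<in> carrier L; h \<in> H\<rbrakk> \<Longrightarrow> x \<otimes>\<^bsub>L\<^esub> h \<in> H"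
    using assms by (auto simp: leibniz_ideal_def)
  have H: "x \<in> carrier L" if "x \<in> H" for x
    using submoduleE(1)[OF sub] that by blast
  interpret H: module F "L\<lparr>carrier := H\<rparr>"
    using submodule.submodule_is_module[OF sub module_axioms] .
  show ?thesis
  proof
    show "(\<lambda>y. x \<otimes>\<^bsub>L\<lparr>carrier := H\<rparr>\<^esub> y) \<in> module_hom F (L\<lparr>carrier := H\<rparr>) (L\<lparr>carrier := H\<rparr>)"
      if "x \<in> carrier (L\<lparr>carrier := H\<rparr>)" for x
      using mult_linear_right[of x] that ideal H by (auto simp: module_hom_def)
    show "(\<lambda>x. x \<otimes>\<^bsub>L\<lparr>carrier := H\<rparr>\<^esub> y) \<in> module_hom F (L\<lparr>carrier := H\<rparr>) (L\<lparr>carrier := H\<rparr>)"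
      if "y \<in> carrier (L\<lparr>carrier := H\<rparr>)" for y
      using mult_linear_left[of y] that ideal H by (auto simp: module_hom_def)
    show "x \<otimes>\<^bsub>?H\<^esub> (y \<otimes>\<^bsub>?H\<^esub> z) = (x \<otimes>\<^bsub>?H\<^esub> y) \<otimes>\<^bsub>?H\<^esub> z \<oplus>\<^bsub>?H\<^esub> y \<otimes>\<^bsub>?H\<^esub> (x \<otimes>\<^bsub>?H\<^esub> z)"
      if "x \<in> carrier ?H" "y \<in> carrier ?H" "z \<in> carrier ?H" for x y z
      using leibniz_identity[of x y z] that H by simp
  qed
qed

text \<open>Two-sidedness gives well-definedness: \<open>(h + x)(k + y)\<close> differs from
  \<open>x y\<close> by \<open>h (k + y) + x k\<close>, which lies in \<open>H\<close>. The laws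
  then descend along the surjective projection.\<close>

lemma leibniz_algebra_quotient:
  assumes "leibniz_ideal F H L"
  shows "leibniz_algebra F (quot_module L H)"
    and "\<And>x y. \<lbrakk>x \<in> carrier L; y \<in> carrier L\<rbrakk> \<Longrightarrow>
      quot_proj L H (x \<otimes>\<^bsub>L\<^esub> y) = quot_proj L H x \<otimes>\<^bsub>quot_module L H\<^esub> quot_proj L H y"
proof -
  have sub: "submodule H F L"
    and ideal: "\<And>x h. \<lbrakk>x \<in> carrier L; h \<in> H\<rbrakk> \<Longrightarrow> x \<otimes>\<^bsub>L\<^esub> h \<in> H \<and> h \<otimes>\<^bsub>L\<^esub> x \<in> H"
    using assms by (auto simp: leibniz_ideal_def)
  interpret S: quotient_space F L H
    using sub by (simp add: quotient_space_def module_axioms)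
  interpret Q: module F "quot_module L H" by (rule S.module_quot)
  show mult: "S.proj (x \<otimes>\<^bsub>L\<^esub> y) = S.proj x \<otimes>\<^bsub>S.Q\<^esub> S.proj y"
    if x: "x \<in> carrier L" and y: "y \<in> carrier L" for x y
  proof (rule S.quot_mult[OF x y])
    fix x' y' assume x'y': "x' \<in> carrier L" "y' \<in> carrier L" "S.proj x' = S.proj x" "S.proj y' = S.proj y"
    then obtain h k where h: "h \<in> H" "x' = h \<oplus>\<^bsub>L\<^esub> x" and k: "k \<in> H" "y' = k \<oplus>\<^bsub>L\<^esub> y"
      using x y by (auto simp: S.proj_eq_iff)
    have "x' \<otimes>\<^bsub>L\<^esub> y' = h \<otimes>\<^bsub>L\<^esub> y' \<oplus>\<^bsub>L\<^esub> x \<otimes>\<^bsub>L\<^esub> y'"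
      using h x x'y'(2) module_hom_add[OF mult_linear_left] by simp
    also have "x \<otimes>\<^bsub>L\<^esub> y' = x \<otimes>\<^bsub>L\<^esub> k \<oplus>\<^bsub>L\<^esub> x \<otimes>\<^bsub>L\<^esub> y"
      using k x y module_hom_add[OF mult_linear_right] by simp
    finally have "x' \<otimes>\<^bsub>L\<^esub> y' = (h \<otimes>\<^bsub>L\<^esub> y' \<oplus>\<^bsub>L\<^esub> x \<otimes>\<^bsub>L\<^esub> k) \<oplus>\<^bsub>L\<^esub> x \<otimes>\<^bsub>L\<^esub> y"
      using h k x y x'y'(2) by (simp add: mult_closed M.a_assoc)
    moreover have "h \<otimes>\<^bsub>L\<^esub> y' \<oplus>\<^bsub>L\<^esub> x \<otimes>\<^bsub>L\<^esub> k \<in> H"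
      using ideal h k x x'y'(2) S.a_closed by blast
    ultimately show "S.proj (x' \<otimes>\<^bsub>L\<^esub> y') = S.proj (x \<otimes>\<^bsub>L\<^esub> y)"
      using x y x'y'(1,2) by (auto simp: S.proj_eq_iff mult_closed)
  qed
  have lin_r: "x \<otimes>\<^bsub>L\<^esub> (y \<oplus>\<^bsub>L\<^esub> z) = x \<otimes>\<^bsub>L\<^esub> y \<oplus>\<^bsub>L\<^esub> x \<otimes>\<^bsub>L\<^esub> z"
    "c \<in> carrier F \<Longrightarrow> x \<otimes>\<^bsub>L\<^esub> (c \<odot>\<^bsub>L\<^esub> y) = c \<odot>\<^bsub>L\<^esub> (x \<otimes>\<^bsub>L\<^esub> y)"
    if "x \<in> carrier L" "y \<in> carrier L" "z \<in> carrier L" for c x y z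
    using module_hom_add[OF mult_linear_right] module_hom_smult[OF mult_linear_right] that by blast+
  have lin_l: "(y \<oplus>\<^bsub>L\<^esub> z) \<otimes>\<^bsub>L\<^esub> x = y \<otimes>\<^bsub>L\<^esub> x \<oplus>\<^bsub>L\<^esub> z \<otimes>\<^bsub>L\<^esub> x"
    "c \<in> carrier F \<Longrightarrow> (c \<odot>\<^bsub>L\<^esub> y) \<otimes>\<^bsub>L\<^esub> x = c \<odot>\<^bsub>L\<^esub> (y \<otimes>\<^bsub>L\<^esub> x)"
    if "x \<in> carrier L" "y \<in> carrier L" "z \<in> carrier L" for c x y z
    using module_hom_add[OF mult_linear_left] module_hom_smult[OF mult_linear_left] that by blast+
  \<comment> \<open>Oriented so that every operation of the quotient is gathered inside a single
    projection, where the corresponding law of \<open>L\<close> applies.\<close>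
  note push = mult[symmetric] S.proj_add[symmetric] S.proj_smult[symmetric] mult_closed lin_r lin_l
  show "leibniz_algebra F S.Q"
  proof
    show "(\<lambda>Y. X \<otimes>\<^bsub>S.Q\<^esub> Y) \<in> module_hom F S.Q S.Q" if "X \<in> carrier S.Q" for X
      using that by (intro module_homI) (auto simp: S.carrier_quot push)
    show "(\<lambda>X. X \<otimes>\<^bsub>S.Q\<^esub> Y) \<in> module_hom F S.Q S.Q" if "Y \<in> carrier S.Q" for Y
      using that by (intro module_homI) (auto simp: S.carrier_quot push)
    fix X Y Z assume "X \<in> carrier S.Q" "Y \<in> carrier S.Q" "Z \<in> carrier S.Q"
    then obtain x y z where xyz: "x \<in> carrier L" "y \<in> carrier L" "z \<in> carrier L"
      "X = S.proj x" "Y = S.proj y" "Z = S.proj z"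
      by (auto simp: S.carrier_quot)
    then show "X \<otimes>\<^bsub>S.Q\<^esub> (Y \<otimes>\<^bsub>S.Q\<^esub> Z) = (X \<otimes>\<^bsub>S.Q\<^esub> Y) \<otimes>\<^bsub>S.Q\<^esub> Z \<oplus>\<^bsub>S.Q\<^esub> Y \<otimes>\<^bsub>S.Q\<^esub> (X \<otimes>\<^bsub>S.Q\<^esub> Z)"
      using leibniz_identity[of x y z] by (simp add: push)
  qed
qed

end

text \<open>Instantiated below for \<open>L\<close>, \<open>H\<close> and \<open>L/H\<close> with
  the same \<open>A\<close>, so that the theory of \<open>Hom\<close> and of cohomology is developed
  once.\<close>

locale leibniz_cochains = B: leibniz_algebra F B + A: central_module F A
  for F :: "('f, 'r) ring_scheme" and B :: "('f, 'b, 'm) module_scheme"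
    and A :: "('f, 'a, 'n) module_scheme"
begin

section \<open>Homomorphisms into a central module\<close>

lemma module_hom_restrict_iff: "restrict g (carrier B) \<in> module_hom F B A \<longleftrightarrow> g \<in> module_hom F B A"
  by (rule module_hom_cong[OF B.module_axioms]) simp

text \<open>Products in \<open>A\<close> are zero, so multiplicativity of a linear map means that it
  vanishes on all products.\<close>

lemma leibniz_hom_iff:
  "\<phi> \<in> leibniz_hom F B A \<longleftrightarrow> \<phi> \<in> extensional (carrier B) \<and> \<phi> \<in> module_hom F B A \<and>
    (\<forall>x\<in>carrier B. \<forall>y\<in>carrier B. \<phi> (x \<otimes>\<^bsub>B\<^esub> y) = \<zero>\<^bsub>A\<^esub>)"
proof -
  have "\<phi> x \<otimes>\<^bsub>A\<^esub> \<phi> y = \<zero>\<^bsub>A\<^esub>"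
    if "\<phi> \<in> module_hom F B A" "x \<in> carrier B" "y \<in> carrier B" for x y
    using that module_hom_closed A.mult_zero by metis
  then show ?thesis
    by (auto simp: leibniz_hom_def PiE_iff module_hom_closed)
qed

lemma restrict_leibniz_hom_iff:
  "restrict g (carrier B) \<in> leibniz_hom F B A \<longleftrightarrow>
    g \<in> module_hom F B A \<and> (\<forall>x\<in>carrier B. \<forall>y\<in>carrier B. g (x \<otimes>\<^bsub>B\<^esub> y) = \<zero>\<^bsub>A\<^esub>)"
  by (auto simp: leibniz_hom_iff module_hom_restrict_iff B.mult_closed)

lemma module_Hom: "module F (Hom F B A)"
  unfolding Hom_def
proof (rule module_pointwise_module[OF A.module_axioms])
  show "leibniz_hom F B A \<subseteq> carrier B \<rightarrow>\<^sub>E carrier A"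
    by (auto simp: leibniz_hom_def)
  show "(\<lambda>x\<in>carrier B. \<zero>\<^bsub>A\<^esub>) \<in> leibniz_hom F B A"
    by (simp add: restrict_leibniz_hom_iff module_hom_pointwise_zero A.module_axioms)
  show "(\<lambda>x\<in>carrier B. g x \<oplus>\<^bsub>A\<^esub> h x) \<in> leibniz_hom F B A"
    if "g \<in> leibniz_hom F B A" "h \<in> leibniz_hom F B A" for g h
    using that unfolding restrict_leibniz_hom_iff
    by (auto simp: leibniz_hom_iff module_hom_pointwise_add A.module_axioms)
  show "(\<lambda>x\<in>carrier B. c \<odot>\<^bsub>A\<^esub> g x) \<in> leibniz_hom F B A"
    if "c \<in> carrier F" "g \<in> leibniz_hom F B A" for c g
    using that unfolding restrict_leibniz_hom_iff
    by (auto simp: leibniz_hom_iff module_hom_pointwise_smult A.module_axioms)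
qed

lemma Hom_simps:
  "carrier (Hom F B A) = leibniz_hom F B A"
  "\<zero>\<^bsub>Hom F B A\<^esub> = (\<lambda>x\<in>carrier B. \<zero>\<^bsub>A\<^esub>)"
  "g \<oplus>\<^bsub>Hom F B A\<^esub> h = (\<lambda>x\<in>carrier B. g x \<oplus>\<^bsub>A\<^esub> h x)"
  "c \<odot>\<^bsub>Hom F B A\<^esub> g = (\<lambda>x\<in>carrier B. c \<odot>\<^bsub>A\<^esub> g x)"
  by (simp_all add: Hom_def pointwise_module_def)

section \<open>Two-cocycles and two-coboundaries\<close>

lemma Z2_simps:
  "carrier (Z2 F B A) = cocycles2 F B A"
  "\<zero>\<^bsub>Z2 F B A\<^esub> = (\<lambda>p\<in>carrier B \<times> carrier B. \<zero>\<^bsub>A\<^esub>)"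
  "f \<oplus>\<^bsub>Z2 F B A\<^esub> g = (\<lambda>p\<in>carrier B \<times> carrier B. f p \<oplus>\<^bsub>A\<^esub> g p)"
  "c \<odot>\<^bsub>Z2 F B A\<^esub> f = (\<lambda>p\<in>carrier B \<times> carrier B. c \<odot>\<^bsub>A\<^esub> f p)"
  by (simp_all add: Z2_def pointwise_module_def)

lemma cocycles2_iff:
  "f \<in> cocycles2 F B A \<longleftrightarrow> f \<in> extensional (carrier B \<times> carrier B) \<and>
    (\<forall>i\<in>carrier B. (\<lambda>j. f (i, j)) \<in> module_hom F B A) \<and>
    (\<forall>j\<in>carrier B. (\<lambda>i. f (i, j)) \<in> module_hom F B A) \<and>
    (\<forall>i\<in>carrier B. \<forall>j\<in>carrier B. \<forall>k\<in>carrier B.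
      f (i, j \<otimes>\<^bsub>B\<^esub> k) = f (i \<otimes>\<^bsub>B\<^esub> j, k) \<oplus>\<^bsub>A\<^esub> f (j, i \<otimes>\<^bsub>B\<^esub> k))"
proof -
  have "f \<in> carrier B \<times> carrier B \<rightarrow>\<^sub>E carrier A \<longleftrightarrow> f \<in> extensional (carrier B \<times> carrier B)"
    if "\<forall>i\<in>carrier B. (\<lambda>j. f (i, j)) \<in> module_hom F B A"
    using that by (auto simp: PiE_iff module_hom_def)
  then show ?thesis unfolding cocycles2_def by blast
qed

text \<open>The form in which explicitly given cocycles are checked: the restriction to pairs in the
  carrier affects none of the conditions, as \<open>B\<close> is closed under its
  operations.\<close>

lemma restrict_cocycles2_iff:
  "restrict f (carrier B \<times> carrier B) \<in> cocycles2 F B A \<longleftrightarrow>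
    (\<forall>i\<in>carrier B. (\<lambda>j. f (i, j)) \<in> module_hom F B A) \<and>
    (\<forall>j\<in>carrier B. (\<lambda>i. f (i, j)) \<in> module_hom F B A) \<and>
    (\<forall>i\<in>carrier B. \<forall>j\<in>carrier B. \<forall>k\<in>carrier B.
      f (i, j \<otimes>\<^bsub>B\<^esub> k) = f (i \<otimes>\<^bsub>B\<^esub> j, k) \<oplus>\<^bsub>A\<^esub> f (j, i \<otimes>\<^bsub>B\<^esub> k))"
proof -
  have "(\<lambda>j. restrict f (carrier B \<times> carrier B) (i, j)) \<in> module_hom F B A \<longleftrightarrow>
      (\<lambda>j. f (i, j)) \<in> module_hom F B A" if "i \<in> carrier B" for i
    using that by (intro module_hom_cong[OF B.module_axioms]) simp
  moreover have "(\<lambda>i. restrict f (carrier B \<times> carrier B) (i, j)) \<in> module_hom F B A \<longleftrightarrow>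
      (\<lambda>i. f (i, j)) \<in> module_hom F B A" if "j \<in> carrier B" for j
    using that by (intro module_hom_cong[OF B.module_axioms]) simp
  ultimately show ?thesis
    by (simp add: cocycles2_iff B.mult_closed)
qed

lemma cocycles2_closed:
  "\<lbrakk>f \<in> cocycles2 F B A; i \<in> carrier B; j \<in> carrier B\<rbrakk> \<Longrightarrow> f (i, j) \<in> carrier A"
  unfolding cocycles2_def by blast

lemma cocycles2_identity:
  "\<lbrakk>f \<in> cocycles2 F B A; i \<in> carrier B; j \<in> carrier B; k \<in> carrier B\<rbrakk> \<Longrightarrow>
    f (i, j \<otimes>\<^bsub>B\<^esub> k) = f (i \<otimes>\<^bsub>B\<^esub> j, k) \<oplus>\<^bsub>A\<^esub> f (j, i \<otimes>\<^bsub>B\<^esub> k)"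
  unfolding cocycles2_def by blast

lemma cocycles2_linear:
  assumes "f \<in> cocycles2 F B A" "i \<in> carrier B"
  shows "(\<lambda>j. f (i, j)) \<in> module_hom F B A" "(\<lambda>j. f (j, i)) \<in> module_hom F B A"
  using assms unfolding cocycles2_def by blast+

lemma module_Z2: "module F (Z2 F B A)"
  unfolding Z2_def
proof (rule module_pointwise_module[OF A.module_axioms])
  show "cocycles2 F B A \<subseteq> carrier B \<times> carrier B \<rightarrow>\<^sub>E carrier A"
    unfolding cocycles2_def by blast
  show "(\<lambda>p\<in>carrier B \<times> carrier B. \<zero>\<^bsub>A\<^esub>) \<in> cocycles2 F B A"
    by (simp add: restrict_cocycles2_iff module_hom_pointwise_zero A.module_axioms)
  show "(\<lambda>p\<in>carrier B \<times> carrier B. f p \<oplus>\<^bsub>A\<^esub> g p) \<in> cocycles2 F B A"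
    if f: "f \<in> cocycles2 F B A" and g: "g \<in> cocycles2 F B A" for f g
    unfolding restrict_cocycles2_iff
  proof (intro conjI ballI)
    show "f (i, j \<otimes>\<^bsub>B\<^esub> k) \<oplus>\<^bsub>A\<^esub> g (i, j \<otimes>\<^bsub>B\<^esub> k) =
        f (i \<otimes>\<^bsub>B\<^esub> j, k) \<oplus>\<^bsub>A\<^esub> g (i \<otimes>\<^bsub>B\<^esub> j, k) \<oplus>\<^bsub>A\<^esub> (f (j, i \<otimes>\<^bsub>B\<^esub> k) \<oplus>\<^bsub>A\<^esub> g (j, i \<otimes>\<^bsub>B\<^esub> k))"
      if "i \<in> carrier B" "j \<in> carrier B" "k \<in> carrier B" for i j k
      using that f g cocycles2_identity[OF f that] cocycles2_identity[OF g that]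
      by (simp add: cocycles2_closed B.mult_closed A.M.a_ac)
  qed (use f g in \<open>auto intro: module_hom_pointwise_add A.module_axioms dest: cocycles2_linear\<close>)
  show "(\<lambda>p\<in>carrier B \<times> carrier B. c \<odot>\<^bsub>A\<^esub> f p) \<in> cocycles2 F B A"
    if c: "c \<in> carrier F" and f: "f \<in> cocycles2 F B A" for c f
    unfolding restrict_cocycles2_iff
  proof (intro conjI ballI)
    show "c \<odot>\<^bsub>A\<^esub> f (i, j \<otimes>\<^bsub>B\<^esub> k) = c \<odot>\<^bsub>A\<^esub> f (i \<otimes>\<^bsub>B\<^esub> j, k) \<oplus>\<^bsub>A\<^esub> c \<odot>\<^bsub>A\<^esub> f (j, i \<otimes>\<^bsub>B\<^esub> k)"
      if "i \<in> carrier B" "j \<in> carrier B" "k \<in> carrier B" for i j k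
      using that c f cocycles2_identity[OF f that]
      by (simp add: cocycles2_closed B.mult_closed A.smult_r_distr)
  qed (use c f in \<open>auto intro: module_hom_pointwise_smult A.module_axioms dest: cocycles2_linear\<close>)
qed

text \<open>The cocycle identity is the Leibniz identity of \<open>B\<close> after application of
  the linear map \<open>- \<epsilon>\<close>.\<close>

lemma coboundary_cocycle:
  assumes "\<epsilon> \<in> module_hom F B A"
  shows "(\<lambda>(i, j)\<in>carrier B \<times> carrier B. \<ominus>\<^bsub>A\<^esub> \<epsilon> (i \<otimes>\<^bsub>B\<^esub> j)) \<in> cocycles2 F B A"
proof -
  have \<delta>: "(\<lambda>x. \<ominus>\<^bsub>A\<^esub> \<epsilon> x) \<in> module_hom F B A"
    using assms by (simp add: module_hom_pointwise_minus A.module_axioms)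
  show ?thesis
    unfolding restrict_cocycles2_iff prod.case
  proof (intro conjI ballI)
    show "\<ominus>\<^bsub>A\<^esub> \<epsilon> (i \<otimes>\<^bsub>B\<^esub> (j \<otimes>\<^bsub>B\<^esub> k)) =
        \<ominus>\<^bsub>A\<^esub> \<epsilon> ((i \<otimes>\<^bsub>B\<^esub> j) \<otimes>\<^bsub>B\<^esub> k) \<oplus>\<^bsub>A\<^esub> \<ominus>\<^bsub>A\<^esub> \<epsilon> (j \<otimes>\<^bsub>B\<^esub> (i \<otimes>\<^bsub>B\<^esub> k))"
      if "i \<in> carrier B" "j \<in> carrier B" "k \<in> carrier B" for i j k
      using that B.leibniz_identity[OF that] module_hom_add[OF \<delta>] by (simp add: B.mult_closed)
  qed (use module_hom_comp[OF B.mult_linear_right \<delta>] module_hom_comp[OF B.mult_linear_left \<delta>] in auto)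
qed

text \<open>Presents the coboundaries as the image of the coboundary map, so that operations on them
  can be carried out on the cochains \<open>\<epsilon>\<close>.\<close>

lemma coboundaries2_eq:
  "coboundaries2 F B A =
    (\<lambda>\<epsilon>. \<lambda>(i, j)\<in>carrier B \<times> carrier B. \<ominus>\<^bsub>A\<^esub> \<epsilon> (i \<otimes>\<^bsub>B\<^esub> j)) ` module_hom F B A"
  (is "_ = ?d ` _")
proof (intro equalityI subsetI)
  fix f assume f: "f \<in> coboundaries2 F B A"
  then obtain \<epsilon> where \<epsilon>: "\<epsilon> \<in> module_hom F B A"
    "\<And>i j. \<lbrakk>i \<in> carrier B; j \<in> carrier B\<rbrakk> \<Longrightarrow> f (i, j) = \<ominus>\<^bsub>A\<^esub> \<epsilon> (i \<otimes>\<^bsub>B\<^esub> j)"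
    by (auto simp: coboundaries2_def)
  have "f = ?d \<epsilon>"
    by (rule extensionalityI[of _ "carrier B \<times> carrier B"])
      (use f \<epsilon>(2) in \<open>auto simp: coboundaries2_def PiE_iff\<close>)
  then show "f \<in> ?d ` module_hom F B A" using \<epsilon>(1) by blast
next
  fix f assume "f \<in> ?d ` module_hom F B A"
  then obtain \<epsilon> where \<epsilon>: "\<epsilon> \<in> module_hom F B A" "f = ?d \<epsilon>" by blast
  then have "f \<in> carrier B \<times> carrier B \<rightarrow>\<^sub>E carrier A"
    unfolding \<epsilon>(2) by (intro restrict_PiE_iff[THEN iffD2]) (auto simp: module_hom_closed B.mult_closed)
  then show "f \<in> coboundaries2 F B A"
    using \<epsilon> by (auto simp: coboundaries2_def intro!: bexI[of _ \<epsilon>])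
qed

text \<open>The coboundary map is linear in \<open>\<epsilon>\<close>, and its image is therefore a
  subspace.\<close>

lemma submodule_coboundaries2: "submodule (coboundaries2 F B A) F (Z2 F B A)"
proof -
  interpret Z: module F "Z2 F B A" by (rule module_Z2)
  let ?d = "\<lambda>\<epsilon>. \<lambda>(i, j)\<in>carrier B \<times> carrier B. \<ominus>\<^bsub>A\<^esub> \<epsilon> (i \<otimes>\<^bsub>B\<^esub> j)"
  have sub: "coboundaries2 F B A \<subseteq> carrier (Z2 F B A)"
    by (auto simp: coboundaries2_eq Z2_simps coboundary_cocycle)
  have smult: "c \<odot>\<^bsub>Z2 F B A\<^esub> f \<in> coboundaries2 F B A"
    if c: "c \<in> carrier F" and f: "f \<in> coboundaries2 F B A" for c f
  proof -
    obtain \<epsilon> where \<epsilon>: "\<epsilon> \<in> module_hom F B A" "f = ?d \<epsilon>" using f by (auto simp: coboundaries2_eq)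
    have "c \<odot>\<^bsub>Z2 F B A\<^esub> f = ?d (\<lambda>x. c \<odot>\<^bsub>A\<^esub> \<epsilon> x)"
      unfolding \<epsilon>(2) Z2_simps using c module_hom_closed[OF \<epsilon>(1)]
      by (intro restrict_ext) (auto simp: B.mult_closed A.smult_r_minus)
    then show ?thesis
      using c \<epsilon>(1) by (auto simp: coboundaries2_eq module_hom_pointwise_smult A.module_axioms)
  qed
  show ?thesis
  proof (rule Z.submoduleI[OF sub])
    have "\<zero>\<^bsub>Z2 F B A\<^esub> = ?d (\<lambda>x. \<zero>\<^bsub>A\<^esub>)"
      unfolding Z2_simps by (intro restrict_ext) (auto simp: A.M.minus_equality[of "\<zero>\<^bsub>A\<^esub>" "\<zero>\<^bsub>A\<^esub>"])
    then show "\<zero>\<^bsub>Z2 F B A\<^esub> \<in> coboundaries2 F B A"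
      by (auto simp: coboundaries2_eq module_hom_pointwise_zero A.module_axioms)
    fix f assume f: "f \<in> coboundaries2 F B A"
    have "\<ominus>\<^bsub>Z2 F B A\<^esub> f = (\<ominus>\<^bsub>F\<^esub> \<one>\<^bsub>F\<^esub>) \<odot>\<^bsub>Z2 F B A\<^esub> f"
      using f sub by (auto simp: Z.smult_l_minus)
    then show "\<ominus>\<^bsub>Z2 F B A\<^esub> f \<in> coboundaries2 F B A"
      using smult f by simp
    fix g assume g: "g \<in> coboundaries2 F B A"
    obtain \<epsilon> where \<epsilon>: "\<epsilon> \<in> module_hom F B A" "f = ?d \<epsilon>" using f by (auto simp: coboundaries2_eq)
    obtain \<eta> where \<eta>: "\<eta> \<in> module_hom F B A" "g = ?d \<eta>" using g by (auto simp: coboundaries2_eq)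
    have "f \<oplus>\<^bsub>Z2 F B A\<^esub> g = ?d (\<lambda>x. \<epsilon> x \<oplus>\<^bsub>A\<^esub> \<eta> x)"
      unfolding \<epsilon>(2) \<eta>(2) Z2_simps using module_hom_closed[OF \<epsilon>(1)] module_hom_closed[OF \<eta>(1)]
      by (intro restrict_ext) (auto simp: B.mult_closed A.M.minus_add)
    then show "f \<oplus>\<^bsub>Z2 F B A\<^esub> g \<in> coboundaries2 F B A"
      using \<epsilon>(1) \<eta>(1) by (auto simp: coboundaries2_eq module_hom_pointwise_add A.module_axioms)
  qed (rule smult)
qed

section \<open>The second cohomology space\<close>

sublocale H2: quotient_space F "Z2 F B A" "coboundaries2 F B A"
  by (simp add: quotient_space_def module_Z2 submodule_coboundaries2)

lemma module_H2: "module F (H2 F B A)"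
  unfolding H2_def by (rule H2.module_quot)

lemma carrier_H2: "carrier (H2 F B A) = coh_class F B A ` cocycles2 F B A"
  using H2.carrier_quot by (simp add: H2_def coh_class_def[abs_def] Z2_simps)

lemma coh_class_add:
  "\<lbrakk>f \<in> cocycles2 F B A; g \<in> cocycles2 F B A\<rbrakk> \<Longrightarrow>
    coh_class F B A f \<oplus>\<^bsub>H2 F B A\<^esub> coh_class F B A g =
    coh_class F B A (\<lambda>p\<in>carrier B \<times> carrier B. f p \<oplus>\<^bsub>A\<^esub> g p)"
  using H2.proj_add[of f g] by (simp add: H2_def coh_class_def Z2_simps)

lemma coh_class_smult:
  "\<lbrakk>c \<in> carrier F; f \<in> cocycles2 F B A\<rbrakk> \<Longrightarrow>
    c \<odot>\<^bsub>H2 F B A\<^esub> coh_class F B A f =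
    coh_class F B A (\<lambda>p\<in>carrier B \<times> carrier B. c \<odot>\<^bsub>A\<^esub> f p)"
  using H2.proj_smult[of c f] by (simp add: H2_def coh_class_def Z2_simps)

text \<open>Passes from cosets to values: the two cocycles differ by a coboundary, whose sign
  convention accounts for the minus before \<open>\<epsilon>\<close>.\<close>

lemma coh_class_eq_iff:
  assumes f: "f \<in> cocycles2 F B A" and g: "g \<in> cocycles2 F B A"
  shows "coh_class F B A f = coh_class F B A g \<longleftrightarrow>
    (\<exists>\<epsilon>\<in>module_hom F B A. \<forall>i\<in>carrier B. \<forall>j\<in>carrier B. f (i, j) = g (i, j) \<ominus>\<^bsub>A\<^esub> \<epsilon> (i \<otimes>\<^bsub>B\<^esub> j))"
proof -
  let ?d = "\<lambda>\<epsilon>. \<lambda>(i, j)\<in>carrier B \<times> carrier B. \<ominus>\<^bsub>A\<^esub> \<epsilon> (i \<otimes>\<^bsub>B\<^esub> j)"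
  have "coh_class F B A f = coh_class F B A g \<longleftrightarrow>
      (\<exists>\<epsilon>\<in>module_hom F B A. f = ?d \<epsilon> \<oplus>\<^bsub>Z2 F B A\<^esub> g)"
    using f g H2.proj_eq_iff by (simp add: coh_class_def Z2_simps(1) coboundaries2_eq)
  moreover have "f = ?d \<epsilon> \<oplus>\<^bsub>Z2 F B A\<^esub> g \<longleftrightarrow>
      (\<forall>i\<in>carrier B. \<forall>j\<in>carrier B. f (i, j) = g (i, j) \<ominus>\<^bsub>A\<^esub> \<epsilon> (i \<otimes>\<^bsub>B\<^esub> j))" (is "_ \<longleftrightarrow> ?R")
    if \<epsilon>: "\<epsilon> \<in> module_hom F B A" for \<epsilon>
  proof -
    have eq: "(?d \<epsilon> \<oplus>\<^bsub>Z2 F B A\<^esub> g) (i, j) = g (i, j) \<ominus>\<^bsub>A\<^esub> \<epsilon> (i \<otimes>\<^bsub>B\<^esub> j)"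
      if "i \<in> carrier B" "j \<in> carrier B" for i j
      using that g module_hom_closed[OF \<epsilon>]
      by (simp add: Z2_simps a_minus_def cocycles2_closed B.mult_closed A.M.a_comm)
    \<comment> \<open>Both sides are extensional, so agreement on pairs from the carrier
      suffices.\<close>
    have "f = ?d \<epsilon> \<oplus>\<^bsub>Z2 F B A\<^esub> g" if ?R
    proof (rule extensionalityI[of _ "carrier B \<times> carrier B"])
      show "f \<in> extensional (carrier B \<times> carrier B)"
        using f unfolding cocycles2_iff by blast
    qed (use that eq in \<open>auto simp: Z2_simps(3)\<close>)
    then show ?thesis using eq by auto
  qed
  ultimately show ?thesis by (simp cong: bex_cong)
qed

lemma coh_class_zero: "\<zero>\<^bsub>H2 F B A\<^esub> = coh_class F B A (\<lambda>p\<in>carrier B \<times> carrier B. \<zero>\<^bsub>A\<^esub>)"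
  using H2.proj_zero by (simp add: H2_def coh_class_def Z2_simps)

lemma coh_class_eq_zero_iff:
  assumes f: "f \<in> cocycles2 F B A"
  shows "coh_class F B A f = \<zero>\<^bsub>H2 F B A\<^esub> \<longleftrightarrow>
    (\<exists>\<epsilon>\<in>module_hom F B A. \<forall>i\<in>carrier B. \<forall>j\<in>carrier B. f (i, j) = \<ominus>\<^bsub>A\<^esub> \<epsilon> (i \<otimes>\<^bsub>B\<^esub> j))"
proof -
  have "(\<lambda>p\<in>carrier B \<times> carrier B. \<zero>\<^bsub>A\<^esub>) \<in> cocycles2 F B A"
    using H2.M.zero_closed by (simp add: Z2_simps)
  then show ?thesis
    using f module_hom_closed[of _ F B A]
    by (simp add: coh_class_zero coh_class_eq_iff a_minus_def B.mult_closed cong: bex_cong)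
qed

text \<open>Identifies the representatives over which the union in \<open>Inf2\<close> runs.\<close>

lemma mem_coh_class:
  assumes "f \<in> cocycles2 F B A"
  shows "g \<in> coh_class F B A f \<longleftrightarrow> g \<in> cocycles2 F B A \<and> coh_class F B A g = coh_class F B A f"
  using H2.mem_proj_iff[of f g] assms by (simp add: coh_class_def Z2_simps)

end

subsection \<open>Central extensions\<close>

locale central_extension = LA: leibniz_cochains F L A
  for F :: "('f, 'r) ring_scheme" and L :: "('f, 'l, 'm) module_scheme"
    and A :: "('f, 'a, 'n) module_scheme" +
  fixes H :: "'l set" and \<mu> :: "'l set \<Rightarrow> 'l"
  assumes central: "central_ideal F H L"
    and linear_section: "linear_section F L (quot_module L H) (quot_proj L H) \<mu>"
begin

lemma ideal: "leibniz_ideal F H L"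
  using central by (simp add: central_ideal_def)

lemma submodule_H: "submodule H F L"
  using ideal by (simp add: leibniz_ideal_def)

sublocale S: quotient_space F L H
  by (simp add: quotient_space_def submodule_H LA.B.module_axioms)

abbreviation \<beta> where "\<beta> \<equiv> quot_proj L H"
abbreviation Q where "Q \<equiv> quot_module L H"
abbreviation LH where "LH \<equiv> L\<lparr>carrier := H\<rparr>"

sublocale HA: leibniz_cochains F LH A
  by (intro leibniz_cochains.intro LA.B.leibniz_algebra_ideal ideal LA.A.central_module_axioms)

sublocale QA: leibniz_cochains F Q A
  by (intro leibniz_cochains.intro LA.B.leibniz_algebra_quotient(1) ideal LA.A.central_module_axioms)

lemma proj_mult: "\<lbrakk>x \<in> carrier L; y \<in> carrier L\<rbrakk> \<Longrightarrow> \<beta> (x \<otimes>\<^bsub>L\<^esub> y) = \<beta> x \<otimes>\<^bsub>Q\<^esub> \<beta> y"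
  by (rule LA.B.leibniz_algebra_quotient(2)[OF ideal])

lemma proj_closed: "x \<in> carrier L \<Longrightarrow> \<beta> x \<in> carrier Q"
  by (rule module_hom_closed[OF S.proj_hom])

lemma section_hom: "\<mu> \<in> module_hom F Q L"
  and proj_section: "X \<in> carrier Q \<Longrightarrow> \<beta> (\<mu> X) = X"
  using linear_section by (simp_all add: linear_section_def)

lemmas section_closed = module_hom_closed[OF section_hom]

lemma H_closed: "h \<in> H \<Longrightarrow> h \<in> carrier L"
  using S.a_subset by blast

lemma proj_H: "h \<in> H \<Longrightarrow> \<beta> h = \<zero>\<^bsub>Q\<^esub>"
  by (simp add: S.proj_eq_zero_iff H_closed)

lemma mult_H:
  assumes "h \<in> H" "x \<in> carrier L"
  shows "h \<otimes>\<^bsub>L\<^esub> x = \<zero>\<^bsub>L\<^esub>" "x \<otimes>\<^bsub>L\<^esub> h = \<zero>\<^bsub>L\<^esub>"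
  using central assms by (auto simp: central_ideal_def leibniz_center_def)

text \<open>\<open>\<kappa>\<close> is the projection onto the first summand of \<open>L = H \<oplus> \<mu> (L/H)\<close>.\<close>

definition \<kappa> where "\<kappa> x = x \<ominus>\<^bsub>L\<^esub> \<mu> (\<beta> x)"

text \<open>\<open>\<beta>\<close> is linear and \<open>\<mu>\<close> splits it, so
  \<open>\<beta>\<close> sends \<open>x\<close> and \<open>\<mu> (\<beta> x)\<close> to the same
  class.\<close>

lemma \<kappa>_in_H: "x \<in> carrier L \<Longrightarrow> \<kappa> x \<in> H"
  using module_hom_diff[OF LA.B.module_axioms S.module_quot S.proj_hom, of x "\<mu> (\<beta> x)"]
  by (simp add: \<kappa>_def S.proj_eq_zero_iff[symmetric] section_closed proj_closed proj_section
      a_minus_def QA.B.M.r_neg)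

lemma \<kappa>_linear: "\<kappa> \<in> module_hom F L L"
proof -
  have "(\<lambda>x. x) \<in> module_hom F L L" by (intro module_homI) auto
  then show ?thesis
    unfolding \<kappa>_def[abs_def]
    by (intro module_hom_pointwise_diff module_hom_comp[OF S.proj_hom section_hom] LA.B.module_axioms)
qed

text \<open>With \<open>H\<close> as target, \<open>\<kappa>\<close> can be followed by a map
  defined on \<open>H\<close> only.\<close>

lemma \<kappa>_hom: "\<kappa> \<in> module_hom F L LH"
  using \<kappa>_linear \<kappa>_in_H by (auto simp: module_hom_def)

text \<open>\<open>\<beta>\<close> kills \<open>h\<close> and the linear map \<open>\<mu>\<close>
  preserves zero. Hence \<open>\<chi> \<circ> \<kappa>\<close> is a linear extension of
  \<open>\<chi>\<close> from \<open>H\<close> to \<open>L\<close>.\<close>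

lemma \<kappa>_H: "h \<in> H \<Longrightarrow> \<kappa> h = h"
  using module_hom_zero[OF S.module_quot LA.B.module_axioms section_hom]
  by (simp add: \<kappa>_def proj_H H_closed a_minus_def
      LA.B.M.minus_equality[of "\<zero>\<^bsub>L\<^esub>" "\<zero>\<^bsub>L\<^esub>"])

lemma \<kappa>_decomp: "x \<in> carrier L \<Longrightarrow> x = \<kappa> x \<oplus>\<^bsub>L\<^esub> \<mu> (\<beta> x)"
  by (simp add: \<kappa>_def a_minus_def section_closed proj_closed LA.B.M.a_assoc LA.B.M.l_neg)

text \<open>Centrality enters here: each factor differs from its lift by an element of
  \<open>H\<close>, which annihilates \<open>L\<close> from both sides.\<close>

lemma section_mult:
  assumes x: "x \<in> carrier L" and y: "y \<in> carrier L"
  shows "\<mu> (\<beta> x) \<otimes>\<^bsub>L\<^esub> \<mu> (\<beta> y) = x \<otimes>\<^bsub>L\<^esub> y"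
proof -
  have [simp]: "\<mu> (\<beta> x) \<in> carrier L" "\<mu> (\<beta> y) \<in> carrier L" "\<kappa> x \<in> carrier L" "\<kappa> y \<in> carrier L"
    using x y by (simp_all add: section_closed proj_closed H_closed \<kappa>_in_H)
  have "x \<otimes>\<^bsub>L\<^esub> y = (\<kappa> x \<oplus>\<^bsub>L\<^esub> \<mu> (\<beta> x)) \<otimes>\<^bsub>L\<^esub> y"
    using \<kappa>_decomp[OF x] by simp
  also have "\<dots> = \<mu> (\<beta> x) \<otimes>\<^bsub>L\<^esub> y"
    using module_hom_add[OF LA.B.mult_linear_left[OF y], of "\<kappa> x" "\<mu> (\<beta> x)"] x y
    by (simp add: mult_H \<kappa>_in_H LA.B.mult_closed)
  also have "\<dots> = \<mu> (\<beta> x) \<otimes>\<^bsub>L\<^esub> (\<kappa> y \<oplus>\<^bsub>L\<^esub> \<mu> (\<beta> y))"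
    using \<kappa>_decomp[OF y] by simp
  also have "\<dots> = \<mu> (\<beta> x) \<otimes>\<^bsub>L\<^esub> \<mu> (\<beta> y)"
    using module_hom_add[OF LA.B.mult_linear_right, of "\<mu> (\<beta> x)" "\<kappa> y" "\<mu> (\<beta> y)"] x y
    by (simp add: mult_H \<kappa>_in_H LA.B.mult_closed)
  finally show ?thesis ..
qed

text \<open>As \<open>\<mu>\<close> is a section, the product of \<open>X\<close> and
  \<open>Y\<close> in \<open>L/H\<close> is the class of \<open>\<mu> X \<mu> Y\<close>, and the
  defining difference is the one in \<open>\<kappa>\<close>.\<close>

lemma section_cocycle_eq:
  "\<lbrakk>X \<in> carrier Q; Y \<in> carrier Q\<rbrakk> \<Longrightarrow> section_cocycle L H \<mu> (X, Y) = \<kappa> (\<mu> X \<otimes>\<^bsub>L\<^esub> \<mu> Y)"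
  by (simp add: section_cocycle_def \<kappa>_def proj_mult section_closed proj_section)

lemma section_cocycle_proj:
  "\<lbrakk>x \<in> carrier L; y \<in> carrier L\<rbrakk> \<Longrightarrow> section_cocycle L H \<mu> (\<beta> x, \<beta> y) = \<kappa> (x \<otimes>\<^bsub>L\<^esub> y)"
  by (simp add: section_cocycle_eq proj_closed section_mult)

text \<open>Products in the central ideal \<open>H\<close> vanish and so do those in
  \<open>A\<close>; multiplicativity only says that zero goes to zero.\<close>

lemma leibniz_hom_LH_iff:
  "\<chi> \<in> leibniz_hom F LH A \<longleftrightarrow> \<chi> \<in> extensional H \<and> \<chi> \<in> module_hom F LH A"
  using module_hom_zero[OF HA.B.module_axioms LA.A.module_axioms, of \<chi>]
  by (auto simp: HA.leibniz_hom_iff mult_H H_closed)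

section \<open>The cocycle representing the transgression\<close>

definition transgression where
  "transgression \<chi> = (\<lambda>p\<in>carrier Q \<times> carrier Q. \<chi> (section_cocycle L H \<mu> p))"

lemma Tra_eq: "Tra F L H A \<mu> \<chi> = coh_class F Q A (transgression \<chi>)"
  by (simp add: Tra_def transgression_def)

text \<open>The cocycle is the linear map \<open>\<chi> \<circ> \<kappa>\<close> applied to
  \<open>\<mu> X \<mu> Y\<close>, which is bilinear; its identity comes from the Leibniz identity of
  \<open>L\<close> at the lifts.\<close>

lemma transgression_cocycle:
  assumes \<chi>: "\<chi> \<in> module_hom F LH A"
  shows "transgression \<chi> \<in> cocycles2 F Q A"
proof -
  have \<chi>\<kappa>: "(\<lambda>x. \<chi> (\<kappa> x)) \<in> module_hom F L A"
    using \<kappa>_hom \<chi> by (rule module_hom_comp)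
  have "transgression \<chi> = (\<lambda>p\<in>carrier Q \<times> carrier Q. \<chi> (\<kappa> (\<mu> (fst p) \<otimes>\<^bsub>L\<^esub> \<mu> (snd p))))"
    unfolding transgression_def by (intro restrict_ext) (auto simp: section_cocycle_eq)
  moreover have "\<dots> \<in> cocycles2 F Q A"
    unfolding QA.restrict_cocycles2_iff fst_conv snd_conv
  proof (intro conjI ballI)
    fix X assume X: "X \<in> carrier Q"
    show "(\<lambda>Y. \<chi> (\<kappa> (\<mu> X \<otimes>\<^bsub>L\<^esub> \<mu> Y))) \<in> module_hom F Q A"
      using module_hom_comp[OF module_hom_comp[OF section_hom LA.B.mult_linear_right] \<chi>\<kappa>] X
      by (simp add: section_closed)
    show "(\<lambda>Y. \<chi> (\<kappa> (\<mu> Y \<otimes>\<^bsub>L\<^esub> \<mu> X))) \<in> module_hom F Q A"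
      using module_hom_comp[OF module_hom_comp[OF section_hom LA.B.mult_linear_left] \<chi>\<kappa>] X
      by (simp add: section_closed)
    fix Y Z assume YZ: "Y \<in> carrier Q" "Z \<in> carrier Q"
    \<comment> \<open>Exhibits the lift of a product as \<open>\<mu> \<circ> \<beta>\<close> of a
      product in \<open>L\<close>, so that \<open>section_mult\<close> can replace it by that
      product wherever it is a factor.\<close>
    have mult: "\<mu> (U \<otimes>\<^bsub>Q\<^esub> V) = \<mu> (\<beta> (\<mu> U \<otimes>\<^bsub>L\<^esub> \<mu> V))" if "U \<in> carrier Q" "V \<in> carrier Q" for U V
      using that by (simp add: proj_mult section_closed proj_section)
    have mult_r: "\<mu> U \<otimes>\<^bsub>L\<^esub> \<mu> (V \<otimes>\<^bsub>Q\<^esub> W) = \<mu> U \<otimes>\<^bsub>L\<^esub> (\<mu> V \<otimes>\<^bsub>L\<^esub> \<mu> W)"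
      and mult_l: "\<mu> (V \<otimes>\<^bsub>Q\<^esub> W) \<otimes>\<^bsub>L\<^esub> \<mu> U = (\<mu> V \<otimes>\<^bsub>L\<^esub> \<mu> W) \<otimes>\<^bsub>L\<^esub> \<mu> U"
      if UVW: "U \<in> carrier Q" "V \<in> carrier Q" "W \<in> carrier Q" for U V W
      using section_mult[of "\<mu> U" "\<mu> V \<otimes>\<^bsub>L\<^esub> \<mu> W"] section_mult[of "\<mu> V \<otimes>\<^bsub>L\<^esub> \<mu> W" "\<mu> U"] UVW
      by (simp_all add: mult LA.B.mult_closed section_closed proj_section)
    show "\<chi> (\<kappa> (\<mu> X \<otimes>\<^bsub>L\<^esub> \<mu> (Y \<otimes>\<^bsub>Q\<^esub> Z))) =
        \<chi> (\<kappa> (\<mu> (X \<otimes>\<^bsub>Q\<^esub> Y) \<otimes>\<^bsub>L\<^esub> \<mu> Z)) \<oplus>\<^bsub>A\<^esub> \<chi> (\<kappa> (\<mu> Y \<otimes>\<^bsub>L\<^esub> \<mu> (X \<otimes>\<^bsub>Q\<^esub> Z)))"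
      using X YZ LA.B.leibniz_identity[of "\<mu> X" "\<mu> Y" "\<mu> Z"]
      by (simp add: mult_r mult_l section_closed LA.B.mult_closed module_hom_add[OF \<chi>\<kappa>])
  qed
  ultimately show ?thesis by simp
qed

section \<open>Inflation of cocycles\<close>

lemma inflate_cocycle_eq:
  "\<lbrakk>x \<in> carrier L; y \<in> carrier L\<rbrakk> \<Longrightarrow> inflate_cocycle L H f (x, y) = f (\<beta> x, \<beta> y)"
  by (simp add: inflate_cocycle_def)

lemma inflate_cocycle:
  assumes f: "f \<in> cocycles2 F Q A"
  shows "inflate_cocycle L H f \<in> cocycles2 F L A"
  unfolding inflate_cocycle_def LA.restrict_cocycles2_iff prod.case
proof (intro conjI ballI)
  fix x assume x: "x \<in> carrier L"
  show "(\<lambda>y. f (\<beta> x, \<beta> y)) \<in> module_hom F L A" "(\<lambda>y. f (\<beta> y, \<beta> x)) \<in> module_hom F L A"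
    using module_hom_comp[OF S.proj_hom QA.cocycles2_linear(1)[OF f]]
      module_hom_comp[OF S.proj_hom QA.cocycles2_linear(2)[OF f]] x
    by (simp_all add: proj_closed)
  fix y z assume yz: "y \<in> carrier L" "z \<in> carrier L"
  show "f (\<beta> x, \<beta> (y \<otimes>\<^bsub>L\<^esub> z)) = f (\<beta> (x \<otimes>\<^bsub>L\<^esub> y), \<beta> z) \<oplus>\<^bsub>A\<^esub> f (\<beta> y, \<beta> (x \<otimes>\<^bsub>L\<^esub> z))"
    using QA.cocycles2_identity[OF f, of "\<beta> x" "\<beta> y" "\<beta> z"] x yz
    by (simp add: proj_mult proj_closed)
qed

text \<open>Cohomologous cocycles have cohomologous inflations: a cochain \<open>\<epsilon>\<close>
  on \<open>L/H\<close> inflates to \<open>\<epsilon> \<circ> \<beta>\<close>. So all sets in the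
  union defining \<open>Inf2\<close> coincide.\<close>

lemma Inf2_coh_class:
  assumes f: "f \<in> cocycles2 F Q A"
  shows "Inf2 F L H A (coh_class F Q A f) = coh_class F L A (inflate_cocycle L H f)"
proof -
  have "coh_class F L A (inflate_cocycle L H g) = coh_class F L A (inflate_cocycle L H f)"
    if "g \<in> coh_class F Q A f" for g
  proof -
    have g: "g \<in> cocycles2 F Q A" and "coh_class F Q A g = coh_class F Q A f"
      using that by (simp_all add: QA.mem_coh_class f)
    then obtain \<epsilon> where \<epsilon>: "\<epsilon> \<in> module_hom F Q A"
      "\<forall>i\<in>carrier Q. \<forall>j\<in>carrier Q. g (i, j) = f (i, j) \<ominus>\<^bsub>A\<^esub> \<epsilon> (i \<otimes>\<^bsub>Q\<^esub> j)"
      using QA.coh_class_eq_iff[OF g f] by blast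
    have "inflate_cocycle L H g (x, y) = inflate_cocycle L H f (x, y) \<ominus>\<^bsub>A\<^esub> \<epsilon> (\<beta> (x \<otimes>\<^bsub>L\<^esub> y))"
      if "x \<in> carrier L" "y \<in> carrier L" for x y
      using that \<epsilon>(2) by (simp add: inflate_cocycle_eq proj_closed proj_mult)
    then show ?thesis
      unfolding LA.coh_class_eq_iff[OF inflate_cocycle[OF g] inflate_cocycle[OF f]]
      by (intro bexI[OF _ module_hom_comp[OF S.proj_hom \<epsilon>(1)]] ballI)
  qed
  moreover have "f \<in> coh_class F Q A f" by (simp add: QA.mem_coh_class f)
  ultimately show ?thesis unfolding Inf2_def by blast
qed

section \<open>The four maps are well defined and linear\<close>

lemma Inf1_leibniz_hom:
  assumes "\<chi> \<in> leibniz_hom F Q A"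
  shows "Inf1 L H \<chi> \<in> leibniz_hom F L A"
  using assms module_hom_comp[OF S.proj_hom, of \<chi> A]
  unfolding Inf1_def LA.restrict_leibniz_hom_iff QA.leibniz_hom_iff
  by (simp add: proj_mult proj_closed)

lemma Inf1_hom: "Inf1 L H \<in> module_hom F (Hom F Q A) (Hom F L A)"
proof (rule module_homI)
  show "Inf1 L H \<chi> \<in> carrier (Hom F L A)" if "\<chi> \<in> carrier (Hom F Q A)" for \<chi>
    using that Inf1_leibniz_hom by (simp add: QA.Hom_simps LA.Hom_simps)
qed (auto simp: QA.Hom_simps LA.Hom_simps Inf1_def proj_closed)

lemma Res_leibniz_hom:
  assumes "\<pi> \<in> leibniz_hom F L A"
  shows "Res H \<pi> \<in> leibniz_hom F LH A"
proof -
  have "\<pi> \<in> module_hom F LH A"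
    using assms H_closed by (auto simp: LA.leibniz_hom_iff module_hom_def)
  then show ?thesis
    using HA.module_hom_restrict_iff[of \<pi>] by (simp add: leibniz_hom_LH_iff Res_def)
qed

lemma Res_hom: "Res H \<in> module_hom F (Hom F L A) (Hom F LH A)"
proof (rule module_homI)
  show "Res H \<pi> \<in> carrier (Hom F LH A)" if "\<pi> \<in> carrier (Hom F L A)" for \<pi>
    using that Res_leibniz_hom by (simp add: HA.Hom_simps LA.Hom_simps)
qed (auto simp: HA.Hom_simps LA.Hom_simps Res_def H_closed)

lemma transgression_apply:
  "\<lbrakk>X \<in> carrier Q; Y \<in> carrier Q\<rbrakk> \<Longrightarrow> transgression \<chi> (X, Y) = \<chi> (section_cocycle L H \<mu> (X, Y))"
  by (simp add: transgression_def)

lemma section_cocycle_in_H: "\<lbrakk>X \<in> carrier Q; Y \<in> carrier Q\<rbrakk> \<Longrightarrow> section_cocycle L H \<mu> (X, Y) \<in> H"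
  by (simp add: section_cocycle_eq \<kappa>_in_H LA.B.mult_closed section_closed)

text \<open>Linearity already holds for the representing cocycles: \<open>section_cocycle\<close>
  takes values in \<open>H\<close>, where the operations of the space of homomorphisms are
  pointwise.\<close>

lemma Tra_hom: "Tra F L H A \<mu> \<in> module_hom F (Hom F LH A) (H2 F Q A)"
proof (rule module_homI)
  show "Tra F L H A \<mu> \<chi> \<in> carrier (H2 F Q A)" if "\<chi> \<in> carrier (Hom F LH A)" for \<chi>
    using that transgression_cocycle
    by (auto simp: Tra_eq QA.carrier_H2 HA.Hom_simps leibniz_hom_LH_iff)
  show "Tra F L H A \<mu> (\<chi> \<oplus>\<^bsub>Hom F LH A\<^esub> \<psi>) = Tra F L H A \<mu> \<chi> \<oplus>\<^bsub>H2 F Q A\<^esub> Tra F L H A \<mu> \<psi>"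
    if "\<chi> \<in> carrier (Hom F LH A)" "\<psi> \<in> carrier (Hom F LH A)" for \<chi> \<psi>
  proof -
    have "transgression (\<chi> \<oplus>\<^bsub>Hom F LH A\<^esub> \<psi>) =
        (\<lambda>p\<in>carrier Q \<times> carrier Q. transgression \<chi> p \<oplus>\<^bsub>A\<^esub> transgression \<psi> p)"
      unfolding transgression_def HA.Hom_simps
      by (intro restrict_ext) (auto simp: section_cocycle_in_H)
    then show ?thesis
      using that
      by (simp add: Tra_eq QA.coh_class_add transgression_cocycle HA.Hom_simps(1) leibniz_hom_LH_iff)
  qed
  show "Tra F L H A \<mu> (c \<odot>\<^bsub>Hom F LH A\<^esub> \<chi>) = c \<odot>\<^bsub>H2 F Q A\<^esub> Tra F L H A \<mu> \<chi>"
    if "c \<in> carrier F" "\<chi> \<in> carrier (Hom F LH A)" for c \<chi>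
  proof -
    have "transgression (c \<odot>\<^bsub>Hom F LH A\<^esub> \<chi>) =
        (\<lambda>p\<in>carrier Q \<times> carrier Q. c \<odot>\<^bsub>A\<^esub> transgression \<chi> p)"
      unfolding transgression_def HA.Hom_simps
      by (intro restrict_ext) (auto simp: section_cocycle_in_H)
    then show ?thesis
      using that
      by (simp add: Tra_eq QA.coh_class_smult transgression_cocycle HA.Hom_simps(1) leibniz_hom_LH_iff)
  qed
qed

text \<open>After a choice of representatives, inflation commutes with the pointwise operations on
  cocycles.\<close>

lemma Inf2_hom: "Inf2 F L H A \<in> module_hom F (H2 F Q A) (H2 F L A)"
proof (rule module_homI)
  show "Inf2 F L H A C \<in> carrier (H2 F L A)" if "C \<in> carrier (H2 F Q A)" for C
    using that by (auto simp: QA.carrier_H2 LA.carrier_H2 Inf2_coh_class inflate_cocycle)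
  show "Inf2 F L H A (C \<oplus>\<^bsub>H2 F Q A\<^esub> D) = Inf2 F L H A C \<oplus>\<^bsub>H2 F L A\<^esub> Inf2 F L H A D"
    if "C \<in> carrier (H2 F Q A)" "D \<in> carrier (H2 F Q A)" for C D
  proof -
    obtain f g where fg: "f \<in> cocycles2 F Q A" "C = coh_class F Q A f"
        "g \<in> cocycles2 F Q A" "D = coh_class F Q A g"
      using \<open>C \<in> _\<close> \<open>D \<in> _\<close> by (auto simp: QA.carrier_H2)
    let ?s = "\<lambda>p\<in>carrier Q \<times> carrier Q. f p \<oplus>\<^bsub>A\<^esub> g p"
    have "?s \<in> cocycles2 F Q A"
      using QA.H2.M.a_closed[of f g] fg by (simp add: QA.Z2_simps)
    moreover have "inflate_cocycle L H ?s =
        (\<lambda>p\<in>carrier L \<times> carrier L. inflate_cocycle L H f p \<oplus>\<^bsub>A\<^esub> inflate_cocycle L H g p)"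
      unfolding inflate_cocycle_def by (intro restrict_ext) (auto simp: proj_closed)
    ultimately show ?thesis
      using fg by (simp add: QA.coh_class_add LA.coh_class_add Inf2_coh_class inflate_cocycle)
  qed
  show "Inf2 F L H A (c \<odot>\<^bsub>H2 F Q A\<^esub> C) = c \<odot>\<^bsub>H2 F L A\<^esub> Inf2 F L H A C"
    if "c \<in> carrier F" "C \<in> carrier (H2 F Q A)" for c C
  proof -
    obtain f where f: "f \<in> cocycles2 F Q A" "C = coh_class F Q A f"
      using \<open>C \<in> _\<close> by (auto simp: QA.carrier_H2)
    let ?s = "\<lambda>p\<in>carrier Q \<times> carrier Q. c \<odot>\<^bsub>A\<^esub> f p"
    have "?s \<in> cocycles2 F Q A"
      using module.smult_closed[OF QA.module_Z2, of c f] that(1) f by (simp add: QA.Z2_simps)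
    moreover have "inflate_cocycle L H ?s =
        (\<lambda>p\<in>carrier L \<times> carrier L. c \<odot>\<^bsub>A\<^esub> inflate_cocycle L H f p)"
      unfolding inflate_cocycle_def by (intro restrict_ext) (auto simp: proj_closed)
    ultimately show ?thesis
      using f that(1) by (simp add: QA.coh_class_smult LA.coh_class_smult Inf2_coh_class inflate_cocycle)
  qed
qed

section \<open>Exactness at each term\<close>

lemma kernel_Inf1: "a_kernel (Hom F Q A) (Hom F L A) (Inf1 L H) = {\<zero>\<^bsub>Hom F Q A\<^esub>}"
proof -
  interpret HQ: module F "Hom F Q A" by (rule QA.module_Hom)
  have "\<chi> = \<zero>\<^bsub>Hom F Q A\<^esub>"
    if \<chi>: "\<chi> \<in> leibniz_hom F Q A" and zero: "Inf1 L H \<chi> = \<zero>\<^bsub>Hom F L A\<^esub>" for \<chi>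
  proof (rule extensionalityI[of _ "carrier Q"])
    show "\<chi> \<in> extensional (carrier Q)" using \<chi> by (simp add: QA.leibniz_hom_iff)
    \<comment> \<open>Surjectivity of \<open>\<beta>\<close> is what makes \<open>Inf1\<close>
      injective.\<close>
    fix X assume "X \<in> carrier Q"
    then obtain x where "x \<in> carrier L" "X = \<beta> x" by (auto simp: S.carrier_quot)
    then show "\<chi> X = \<zero>\<^bsub>Hom F Q A\<^esub> X"
      using fun_cong[OF zero, of x] by (simp add: Inf1_def LA.Hom_simps QA.Hom_simps proj_closed)
  qed (simp add: QA.Hom_simps)
  moreover have "Inf1 L H \<zero>\<^bsub>Hom F Q A\<^esub> = \<zero>\<^bsub>Hom F L A\<^esub>"
    by (rule module_hom_zero[OF QA.module_Hom LA.module_Hom Inf1_hom])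
  ultimately show ?thesis
    using HQ.M.zero_closed unfolding a_kernel_def' QA.Hom_simps(1) by blast
qed

text \<open>A homomorphism on \<open>L\<close> that vanishes on \<open>H\<close> factors through
  \<open>\<beta>\<close>.\<close>

lemma exact_Hom_L: "Inf1 L H ` carrier (Hom F Q A) = a_kernel (Hom F L A) (Hom F LH A) (Res H)"
proof (intro equalityI subsetI)
  fix \<pi> assume "\<pi> \<in> Inf1 L H ` carrier (Hom F Q A)"
  then obtain \<chi> where \<chi>: "\<chi> \<in> leibniz_hom F Q A" "\<pi> = Inf1 L H \<chi>" by (auto simp: QA.Hom_simps)
  have "\<chi> \<zero>\<^bsub>Q\<^esub> = \<zero>\<^bsub>A\<^esub>"
    using \<chi>(1) module_hom_zero[OF S.module_quot LA.A.module_axioms] by (simp add: QA.leibniz_hom_iff)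
  then have "Res H \<pi> = \<zero>\<^bsub>Hom F LH A\<^esub>"
    unfolding \<chi>(2) Res_def HA.Hom_simps partial_object.simps
    by (auto simp: Inf1_def H_closed proj_H intro!: restrict_ext)
  then show "\<pi> \<in> a_kernel (Hom F L A) (Hom F LH A) (Res H)"
    using \<chi> Inf1_leibniz_hom by (simp add: a_kernel_def' LA.Hom_simps(1))
next
  fix \<pi> assume "\<pi> \<in> a_kernel (Hom F L A) (Hom F LH A) (Res H)"
  then have \<pi>: "\<pi> \<in> leibniz_hom F L A" and res: "Res H \<pi> = \<zero>\<^bsub>Hom F LH A\<^esub>"
    by (simp_all add: a_kernel_def' LA.Hom_simps(1))
  have zero: "\<pi> h = \<zero>\<^bsub>A\<^esub>" if "h \<in> H" for h
    using fun_cong[OF res, of h] that by (simp add: Res_def HA.Hom_simps)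
  have hom: "\<pi> \<in> module_hom F L A" and ext: "\<pi> \<in> extensional (carrier L)"
    and mult: "\<And>x y. \<lbrakk>x \<in> carrier L; y \<in> carrier L\<rbrakk> \<Longrightarrow> \<pi> (x \<otimes>\<^bsub>L\<^esub> y) = \<zero>\<^bsub>A\<^esub>"
    using \<pi> by (simp_all add: LA.leibniz_hom_iff)
  \<comment> \<open>The forced choice: if \<open>\<pi>\<close> is
    \<open>\<chi> \<circ> \<beta>\<close>, then composing with the section returns
    \<open>\<chi>\<close>.\<close>
  let ?\<chi> = "\<lambda>X\<in>carrier Q. \<pi> (\<mu> X)"
  have \<pi>\<mu>: "\<pi> (\<mu> (\<beta> x)) = \<pi> x" if x: "x \<in> carrier L" for x
  proof -
    have "\<pi> x = \<pi> (\<kappa> x \<oplus>\<^bsub>L\<^esub> \<mu> (\<beta> x))" using \<kappa>_decomp[OF x] by simp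
    also have "\<dots> = \<pi> (\<mu> (\<beta> x))"
      using x \<kappa>_in_H[OF x]
      by (simp add: module_hom_add[OF hom] zero H_closed section_closed proj_closed module_hom_closed[OF hom])
    finally show ?thesis ..
  qed
  have mem: "?\<chi> \<in> leibniz_hom F Q A"
    unfolding QA.restrict_leibniz_hom_iff
  proof (intro conjI ballI)
    show "(\<lambda>X. \<pi> (\<mu> X)) \<in> module_hom F Q A" by (rule module_hom_comp[OF section_hom hom])
    fix X Y assume XY: "X \<in> carrier Q" "Y \<in> carrier Q"
    \<comment> \<open>\<open>\<pi>\<close> does not change under
      \<open>\<mu> \<circ> \<beta>\<close> and vanishes on products of \<open>L\<close>.\<close>
    have "\<pi> (\<mu> (\<beta> (\<mu> X \<otimes>\<^bsub>L\<^esub> \<mu> Y))) = \<zero>\<^bsub>A\<^esub>"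
      using XY by (simp add: \<pi>\<mu> mult LA.B.mult_closed section_closed)
    then show "\<pi> (\<mu> (X \<otimes>\<^bsub>Q\<^esub> Y)) = \<zero>\<^bsub>A\<^esub>"
      using XY by (simp add: proj_mult section_closed proj_section)
  qed
  have "Inf1 L H ?\<chi> = \<pi>"
    by (rule extensionalityI[of _ "carrier L"]) (auto simp: Inf1_def ext proj_closed \<pi>\<mu>)
  then show "\<pi> \<in> Inf1 L H ` carrier (Hom F Q A)"
    using imageI[OF mem, of "Inf1 L H"] by (simp only: QA.Hom_simps)
qed

text \<open>The transgression is the obstruction to extending \<open>\<chi>\<close>: a linear
  extension to \<open>L\<close> always exists, and the class decides whether one can be made to
  vanish on products.\<close>

lemma exact_Hom_H:
  "Res H ` carrier (Hom F L A) = a_kernel (Hom F LH A) (H2 F Q A) (Tra F L H A \<mu>)"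
proof (intro equalityI subsetI)
  fix \<chi> assume "\<chi> \<in> Res H ` carrier (Hom F L A)"
  then obtain \<pi> where \<pi>: "\<pi> \<in> leibniz_hom F L A" and \<chi>: "\<chi> = Res H \<pi>" by (auto simp: LA.Hom_simps)
  have hom: "\<pi> \<in> module_hom F L A"
    and mult: "\<And>x y. \<lbrakk>x \<in> carrier L; y \<in> carrier L\<rbrakk> \<Longrightarrow> \<pi> (x \<otimes>\<^bsub>L\<^esub> y) = \<zero>\<^bsub>A\<^esub>"
    using \<pi> by (simp_all add: LA.leibniz_hom_iff)
  have \<chi>_hom: "\<chi> \<in> leibniz_hom F LH A" using Res_leibniz_hom[OF \<pi>] \<chi> by simp
  then have cocycle: "transgression \<chi> \<in> cocycles2 F Q A"
    by (simp add: leibniz_hom_LH_iff transgression_cocycle)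
  \<comment> \<open>\<open>\<pi>\<close> kills \<open>\<mu> X \<mu> Y\<close>, so only the term at
    the lift of the product survives: the coboundary of \<open>\<pi> \<circ> \<mu>\<close>.\<close>
  have "transgression \<chi> (X, Y) = \<ominus>\<^bsub>A\<^esub> \<pi> (\<mu> (X \<otimes>\<^bsub>Q\<^esub> Y))"
    if XY: "X \<in> carrier Q" "Y \<in> carrier Q" for X Y
  proof -
    have "transgression \<chi> (X, Y) = \<pi> (section_cocycle L H \<mu> (X, Y))"
      using XY by (simp add: transgression_apply \<chi> Res_def section_cocycle_in_H)
    also have "\<dots> = \<pi> (\<mu> X \<otimes>\<^bsub>L\<^esub> \<mu> Y) \<ominus>\<^bsub>A\<^esub> \<pi> (\<mu> (X \<otimes>\<^bsub>Q\<^esub> Y))"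
      using XY module_hom_diff[OF LA.B.module_axioms LA.A.module_axioms hom]
      by (simp add: section_cocycle_def LA.B.mult_closed QA.B.mult_closed section_closed)
    finally show ?thesis
      using XY module_hom_closed[OF hom]
      by (simp add: mult section_closed QA.B.mult_closed a_minus_def)
  qed
  then have "Tra F L H A \<mu> \<chi> = \<zero>\<^bsub>H2 F Q A\<^esub>"
    unfolding Tra_eq QA.coh_class_eq_zero_iff[OF cocycle]
    by (intro bexI[OF _ module_hom_comp[OF section_hom hom]] ballI)
  then show "\<chi> \<in> a_kernel (Hom F LH A) (H2 F Q A) (Tra F L H A \<mu>)"
    using \<chi>_hom by (simp add: a_kernel_def' HA.Hom_simps(1))
next
  fix \<chi> assume "\<chi> \<in> a_kernel (Hom F LH A) (H2 F Q A) (Tra F L H A \<mu>)"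
  then have "\<chi> \<in> leibniz_hom F LH A" and tra: "Tra F L H A \<mu> \<chi> = \<zero>\<^bsub>H2 F Q A\<^esub>"
    by (simp_all add: a_kernel_def' HA.Hom_simps(1))
  then have hom: "\<chi> \<in> module_hom F LH A" and ext: "\<chi> \<in> extensional H"
    by (simp_all add: leibniz_hom_LH_iff)
  obtain \<epsilon> where \<epsilon>: "\<epsilon> \<in> module_hom F Q A"
    and tr: "\<forall>X\<in>carrier Q. \<forall>Y\<in>carrier Q. transgression \<chi> (X, Y) = \<ominus>\<^bsub>A\<^esub> \<epsilon> (X \<otimes>\<^bsub>Q\<^esub> Y)"
    using tra QA.coh_class_eq_zero_iff[OF transgression_cocycle[OF hom]] by (auto simp: Tra_eq)
  have eq: "\<chi> (\<kappa> (x \<otimes>\<^bsub>L\<^esub> y)) = \<ominus>\<^bsub>A\<^esub> \<epsilon> (\<beta> (x \<otimes>\<^bsub>L\<^esub> y))"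
    if "x \<in> carrier L" "y \<in> carrier L" for x y
    using that bspec[OF bspec[OF tr, of "\<beta> x"], of "\<beta> y"]
    by (simp add: transgression_apply section_cocycle_proj proj_closed proj_mult)
  \<comment> \<open>The second summand cancels the first on products by \<open>eq\<close>, and
    leaves the values on \<open>H\<close> unchanged because \<open>\<beta>\<close> vanishes
    there.\<close>
  let ?\<pi> = "\<lambda>x\<in>carrier L. \<chi> (\<kappa> x) \<oplus>\<^bsub>A\<^esub> \<epsilon> (\<beta> x)"
  have mem: "?\<pi> \<in> leibniz_hom F L A"
    unfolding LA.restrict_leibniz_hom_iff
  proof (intro conjI ballI)
    show "(\<lambda>x. \<chi> (\<kappa> x) \<oplus>\<^bsub>A\<^esub> \<epsilon> (\<beta> x)) \<in> module_hom F L A"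
      by (intro module_hom_pointwise_add module_hom_comp[OF \<kappa>_hom hom] module_hom_comp[OF S.proj_hom \<epsilon>]
          LA.A.module_axioms)
  qed (simp add: eq LA.A.M.l_neg module_hom_closed[OF \<epsilon>] proj_closed LA.B.mult_closed)
  have "Res H ?\<pi> = \<chi>"
    using module_hom_closed[OF hom] module_hom_zero[OF S.module_quot LA.A.module_axioms \<epsilon>]
    by (intro extensionalityI[of _ H]) (auto simp: Res_def ext H_closed \<kappa>_H proj_H)
  then show "\<chi> \<in> Res H ` carrier (Hom F L A)"
    using imageI[OF mem, of "Res H"] by (simp only: LA.Hom_simps)
qed

text \<open>On \<open>L\<close> the map \<open>\<kappa>\<close> provides a cochain bounding the
  inflated transgression. Conversely, a bounding cochain splits along \<open>H\<close> and the image
  of \<open>\<mu>\<close>: its part on \<open>H\<close> gives \<open>\<chi>\<close>, its part along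
  \<open>\<mu>\<close> a coboundary on \<open>L/H\<close>.\<close>

lemma exact_H2_quotient:
  "Tra F L H A \<mu> ` carrier (Hom F LH A) = a_kernel (H2 F Q A) (H2 F L A) (Inf2 F L H A)"
proof (intro equalityI subsetI)
  fix C assume "C \<in> Tra F L H A \<mu> ` carrier (Hom F LH A)"
  then obtain \<chi> where \<chi>: "\<chi> \<in> module_hom F LH A" and C: "C = coh_class F Q A (transgression \<chi>)"
    by (auto simp: HA.Hom_simps Tra_eq leibniz_hom_LH_iff)
  note cocycle = transgression_cocycle[OF \<chi>]
  have \<chi>\<kappa>: "(\<lambda>x. \<chi> (\<kappa> x)) \<in> module_hom F L A"
    using \<kappa>_hom \<chi> by (rule module_hom_comp)
  \<comment> \<open>The double minus fits the sign convention of coboundaries, with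
    \<open>- \<chi> \<circ> \<kappa>\<close> as the cochain.\<close>
  have "inflate_cocycle L H (transgression \<chi>) (x, y) = \<ominus>\<^bsub>A\<^esub> (\<ominus>\<^bsub>A\<^esub> \<chi> (\<kappa> (x \<otimes>\<^bsub>L\<^esub> y)))"
    if "x \<in> carrier L" "y \<in> carrier L" for x y
    using that module_hom_closed[OF \<chi>\<kappa>]
    by (simp add: inflate_cocycle_eq transgression_apply section_cocycle_proj proj_closed LA.B.mult_closed)
  then have "Inf2 F L H A C = \<zero>\<^bsub>H2 F L A\<^esub>"
    unfolding C Inf2_coh_class[OF cocycle] LA.coh_class_eq_zero_iff[OF inflate_cocycle[OF cocycle]]
    by (intro bexI[OF _ module_hom_pointwise_minus[OF LA.A.module_axioms \<chi>\<kappa>]] ballI)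
  then show "C \<in> a_kernel (H2 F Q A) (H2 F L A) (Inf2 F L H A)"
    using cocycle by (simp add: a_kernel_def' QA.carrier_H2 C)
next
  fix C assume "C \<in> a_kernel (H2 F Q A) (H2 F L A) (Inf2 F L H A)"
  then obtain f where f: "f \<in> cocycles2 F Q A" and C: "C = coh_class F Q A f"
    and "Inf2 F L H A C = \<zero>\<^bsub>H2 F L A\<^esub>"
    by (auto simp: a_kernel_def' QA.carrier_H2)
  then obtain \<epsilon> where \<epsilon>: "\<epsilon> \<in> module_hom F L A"
    and "\<forall>x\<in>carrier L. \<forall>y\<in>carrier L. inflate_cocycle L H f (x, y) = \<ominus>\<^bsub>A\<^esub> \<epsilon> (x \<otimes>\<^bsub>L\<^esub> y)"
    using LA.coh_class_eq_zero_iff[OF inflate_cocycle[OF f]] by (auto simp: Inf2_coh_class)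
  \<comment> \<open>Evaluation at the lifts recovers \<open>f\<close> from its inflation, as
    \<open>\<beta> (\<mu> X)\<close> is \<open>X\<close>.\<close>
  then have f_eq: "f (X, Y) = \<ominus>\<^bsub>A\<^esub> \<epsilon> (\<mu> X \<otimes>\<^bsub>L\<^esub> \<mu> Y)" if "X \<in> carrier Q" "Y \<in> carrier Q" for X Y
    using that inflate_cocycle_eq[of "\<mu> X" "\<mu> Y" f] by (simp add: section_closed proj_section)
  let ?\<chi> = "\<lambda>h\<in>H. \<ominus>\<^bsub>A\<^esub> \<epsilon> h"
  have "(\<lambda>x. \<ominus>\<^bsub>A\<^esub> \<epsilon> x) \<in> module_hom F L A"
    by (rule module_hom_pointwise_minus[OF LA.A.module_axioms \<epsilon>])
  then have "(\<lambda>h. \<ominus>\<^bsub>A\<^esub> \<epsilon> h) \<in> module_hom F LH A"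
    using H_closed by (auto simp: module_hom_def)
  then have \<chi>: "?\<chi> \<in> module_hom F LH A"
    using HA.module_hom_restrict_iff by simp
  \<comment> \<open>Linearity of \<open>\<epsilon>\<close> splits the value into
    \<open>- \<epsilon> (\<mu> X \<mu> Y)\<close>, which is \<open>f (X, Y)\<close>, and a
    remainder, the coboundary of \<open>- \<epsilon> \<circ> \<mu>\<close>.\<close>
  have "transgression ?\<chi> (X, Y) = f (X, Y) \<ominus>\<^bsub>A\<^esub> (\<ominus>\<^bsub>A\<^esub> \<epsilon> (\<mu> (X \<otimes>\<^bsub>Q\<^esub> Y)))"
    if XY: "X \<in> carrier Q" "Y \<in> carrier Q" for X Y
  proof -
    have "transgression ?\<chi> (X, Y) = \<ominus>\<^bsub>A\<^esub> \<epsilon> (\<mu> X \<otimes>\<^bsub>L\<^esub> \<mu> Y \<ominus>\<^bsub>L\<^esub> \<mu> (X \<otimes>\<^bsub>Q\<^esub> Y))"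
      using XY section_cocycle_in_H[OF XY] by (simp add: transgression_apply section_cocycle_def)
    also have "\<dots> = \<ominus>\<^bsub>A\<^esub> (\<epsilon> (\<mu> X \<otimes>\<^bsub>L\<^esub> \<mu> Y) \<ominus>\<^bsub>A\<^esub> \<epsilon> (\<mu> (X \<otimes>\<^bsub>Q\<^esub> Y)))"
      using XY module_hom_diff[OF LA.B.module_axioms LA.A.module_axioms \<epsilon>]
      by (simp add: LA.B.mult_closed QA.B.mult_closed section_closed)
    finally show ?thesis
      using XY by (simp add: f_eq a_minus_def LA.A.M.minus_add LA.B.mult_closed QA.B.mult_closed
          section_closed module_hom_closed[OF \<epsilon>])
  qed
  then have "Tra F L H A \<mu> ?\<chi> = C"
    unfolding Tra_eq C QA.coh_class_eq_iff[OF transgression_cocycle[OF \<chi>] f]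
    by (intro bexI[OF _ module_hom_pointwise_minus[OF LA.A.module_axioms
        module_hom_comp[OF section_hom \<epsilon>]]] ballI)
  moreover have "?\<chi> \<in> carrier (Hom F LH A)"
    using \<chi> by (simp add: HA.Hom_simps leibniz_hom_LH_iff)
  ultimately show "C \<in> Tra F L H A \<mu> ` carrier (Hom F LH A)" by blast
qed

end

theorem theorem3p1:
  fixes F :: "('f, 'r) ring_scheme"
    and L :: "('f, 'l, 'm) module_scheme"
    and A :: "('f, 'a, 'n) module_scheme"
    and H :: "'l set"
    and \<mu> :: "'l set \<Rightarrow> 'l"
  assumes "leibniz_algebra F L"
    and "central_ideal F H L"
    and "linear_section F L (quot_module L H) (quot_proj L H) \<mu>"
    and "central_module F A"
  shows
    "a_kernel (Hom F (quot_module L H) A) (Hom F L A) (Inf1 L H) = {\<zero>\<^bsub>Hom F (quot_module L H) A\<^esub>} \<and>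
     exact_at F (Hom F (quot_module L H) A) (Hom F L A) (Hom F (L\<lparr>carrier := H\<rparr>) A)
       (Inf1 L H) (Res H) \<and>
     exact_at F (Hom F L A) (Hom F (L\<lparr>carrier := H\<rparr>) A) (H2 F (quot_module L H) A)
       (Res H) (Tra F L H A \<mu>) \<and>
     exact_at F (Hom F (L\<lparr>carrier := H\<rparr>) A) (H2 F (quot_module L H) A) (H2 F L A)
       (Tra F L H A \<mu>) (Inf2 F L H A)"
proof -
  interpret central_extension F L A H \<mu>
    using assms by (simp add: central_extension_def leibniz_cochains_def central_extension_axioms_def)
  show ?thesis
    unfolding exact_at_def
    by (intro conjI kernel_Inf1 exact_Hom_L exact_Hom_H exact_H2_quotient Inf1_hom Res_hom Tra_hom
        Inf2_hom LA.module_Hom HA.module_Hom QA.module_Hom LA.module_H2 QA.module_H2)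
qed

end
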